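(* There is a universal constant $c>0$ such that the following holds. Let $\Omega\subset\mathbb R^d$ be compact, $\mu$ a probability measure on $\Omega$, $q\in(2,\infty)$, $B>0$, and let $X_N$ be an $N$-dimensional subspace of $\mathcal C(\Omega)$ satisfying, for all integers $k\ge0$, $$ e_k(X_N^q,L_\infty)\le B\begin{cases}(N/2^k)^{1/q}, & k\le\log N,\\ 2^{-2^k/N}, & k\ge\log N.\end{cases} $$ Then for every integer $$ m\ge cq^2B^qN^{1-2/q}\max\Big\{\Big(\frac{N^{1/2}-N^{1/q}}{1/2-1/q}\Big)^2,\,N\Big\} $$ there are $m$ points $\xi^1,\dots,\xi^m\in\Omega$ such that $$ \frac12\|f\|_q^q\le\frac1m\sum_{j=1}^m|f(\xi^j)|^q\le\frac32\|f\|_q^q\qquad\forall f\in X_N. $$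
   Context: $\|f\|_q=(\int_\Omega|f|^qd\mu)^{1/q}$; $L_\infty$ denotes $\mathcal C(\Omega)$ with the norm $\|f\|_\infty=\max_\Omega|f|$. $X_N^q:=\{f\in X_N:\|f\|_q\le1\}$. For a set $A$ in a metric space with metric $d$, let $N_0=1$ and $N_n=2^{2^n}$ for $n\ge1$, and $e_n(A,d):=\inf\{\varepsilon:\exists f_1,\dots,f_{N_n}\in A,\ A\subset\bigcup_{j=1}^{N_n}\{g:d(f_j,g)<\varepsilon\}\}$; here $e_k(X_N^q,L_\infty)$ uses $d(f,g)=\|f-g\|_\infty$. *)

theory Defs
  imports "HOL-Analysis.Analysis" "HOL-Probability.Probability"
begin

text \<open>Points of R^d are modelled as functions nat => real vanishing at all
  coordinates i >= d (with the product topology, which on this subspace is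
  the Euclidean topology). This lets the dimension d be quantified inside the
  statement, so that the constant c is universal (independent of d).\<close>

definition euclid_pts :: "nat \<Rightarrow> (nat \<Rightarrow> real) set" where
  "euclid_pts d = {x. \<forall>i\<ge>d. x i = 0}"

definition Lq_pow :: "'a measure \<Rightarrow> real \<Rightarrow> ('a \<Rightarrow> real) \<Rightarrow> real" where
  "Lq_pow \<mu> q f = (\<integral>x. \<bar>f x\<bar> powr q \<partial>\<mu>)"

definition Lq_norm :: "'a measure \<Rightarrow> real \<Rightarrow> ('a \<Rightarrow> real) \<Rightarrow> real" where
  "Lq_norm \<mu> q f = (Lq_pow \<mu> q f) powr (1 / q)"

definition sup_dist :: "'a set \<Rightarrow> ('a \<Rightarrow> real) \<Rightarrow> ('a \<Rightarrow> real) \<Rightarrow> real" where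
  "sup_dist \<Omega> f g = (SUP x\<in>\<Omega>. \<bar>f x - g x\<bar>)"

definition Nn :: "nat \<Rightarrow> nat" where
  "Nn n = (if n = 0 then 1 else 2 ^ (2 ^ n))"

text \<open>Entropy numbers e_n(A, L_infty(\<Omega>)); the infimum of the empty set is +infinity.
  Centres f_1..f_{N_n} in A (repetitions allowed, i.e. at most N_n distinct
  centres, at least one).\<close>
definition entropy_num :: "'a set \<Rightarrow> ('a \<Rightarrow> real) set \<Rightarrow> nat \<Rightarrow> ereal" where
  "entropy_num \<Omega> A n = Inf (ereal ` {\<epsilon>. \<exists>F. finite F \<and> F \<noteq> {} \<and> F \<subseteq> A \<and> card F \<le> Nn n \<and>
      A \<subseteq> (\<Union>f\<in>F. {g. sup_dist \<Omega> f g < \<epsilon>})})"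

definition span_fun :: "nat \<Rightarrow> (nat \<Rightarrow> 'a \<Rightarrow> real) \<Rightarrow> ('a \<Rightarrow> real) set" where
  "span_fun N \<phi> = {(\<lambda>x. \<Sum>i<N. a i * \<phi> i x) | a. True}"

definition lin_indep_on :: "'a set \<Rightarrow> nat \<Rightarrow> (nat \<Rightarrow> 'a \<Rightarrow> real) \<Rightarrow> bool" where
  "lin_indep_on \<Omega> N \<phi> \<longleftrightarrow>
     (\<forall>a. (\<forall>x\<in>\<Omega>. (\<Sum>i<N. a i * \<phi> i x) = 0) \<longrightarrow> (\<forall>i<N. a i = 0))"

definition unit_ball_q :: "'a measure \<Rightarrow> real \<Rightarrow> ('a \<Rightarrow> real) set \<Rightarrow> ('a \<Rightarrow> real) set" where
  "unit_ball_q \<mu> q X = {f \<in> X. Lq_norm \<mu> q f \<le> 1}"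

end

theory Submission
  imports Defs
begin

text \<open>
  The points are drawn independently from \<open>\<mu>\<close>. With \<open>R = B * N powr (1/q)\<close>, the bound on the entropy
  number \<open>e_0\<close> says that \<open>\<bar>f\<bar> \<le> R\<close> on the \<open>L_q\<close> unit ball, whence
  \<open>\<Sum>\<^sub>j (\<bar>f (\<xi> j)\<bar> powr q - \<bar>g (\<xi> j)\<bar> powr q)\<^sup>2\<close> is at most
  \<open>q\<^sup>2 * R powr (q - 2) * \<parallel>f - g\<parallel>\<^sub>\<infinity>\<^sup>2 * \<Sum>\<^sub>j (\<bar>f (\<xi> j)\<bar> powr q + \<bar>g (\<xi> j)\<bar> powr q)\<close>.
  After symmetrization, Dudley's chaining in the uniform metric bounds the expected discretization error
  \<open>D\<close> by a small multiple of \<open>1 + D\<close> as soon as \<open>m\<close> exceeds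
  \<open>q\<^sup>2 * R powr (q - 2) * (\<Sum>\<^sub>k 2 powr (k/2) * e_k)\<^sup>2\<close> by a constant factor, and the entropy assumption
  bounds this by the right-hand side of the theorem. Replacing the unit ball by a sufficiently fine
  finite net keeps all suprema finite maxima, hence measurable.
\<close>

subsection \<open>Chaining for Rademacher averages\<close>

text \<open>Hoeffding's lemma for one fair sign, whose moment generating function is
  \<open>cosh\<close>.\<close>

lemma cosh_le_exp_half_square:
  fixes x :: real
  shows "cosh x \<le> exp (x\<^sup>2 / 2)"
proof -
  have nonneg: "cosh y \<le> exp (y\<^sup>2 / 2)" if "y \<ge> 0" for y :: real
  proof -
    \<comment> \<open>The left side is the logarithm of \<open>cosh y\<close>. Hoeffding's bound
      h^2/8 at h = 2y, for success probability 1/2, gives y^2/2.\<close>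
    have "- y + ln ((1 + exp (2 * y)) / 2) \<le> y\<^sup>2 / 2"
      using Hoeffdings_lemma_aux[of "2 * y" "1/2"] that
      by (simp add: power2_eq_square field_simps)
    then have "exp (- y + ln ((1 + exp (2 * y)) / 2)) \<le> exp (y\<^sup>2 / 2)"
      by simp
    moreover have "exp (- y + ln ((1 + exp (2 * y)) / 2)) = exp (- y) * ((1 + exp (2 * y)) / 2)"
      by (subst exp_add, subst exp_ln) (auto intro: add_pos_pos)
    moreover have "exp (- y) * ((1 + exp (2 * y)) / 2) = cosh y"
      by (simp add: cosh_field_def field_simps flip: exp_add)
    ultimately show ?thesis
      by (simp only:)
  qed
  show ?thesis
    using nonneg[of x] nonneg[of "- x"] by (cases "x \<ge> 0") auto
qed

text \<open>Extensionality makes this a finite set, so averages over signs are finite sums and raise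
  no measurability questions.\<close>

definition signs :: "nat \<Rightarrow> (nat \<Rightarrow> real) set" where
  "signs m = (\<Pi>\<^sub>E j\<in>{..<m}. {-1, 1})"

definition sign_avg :: "nat \<Rightarrow> ((nat \<Rightarrow> real) \<Rightarrow> real) \<Rightarrow> real" where
  "sign_avg m g = (\<Sum>\<epsilon>\<in>signs m. g \<epsilon>) / 2 ^ m"

lemma finite_signs [simp]: "finite (signs m)"
  by (simp add: signs_def finite_PiE)

lemma card_signs: "card (signs m) = 2 ^ m"
  by (simp add: signs_def card_PiE numeral_2_eq_2)

lemma signs_cases: "\<epsilon> \<in> signs m \<Longrightarrow> j < m \<Longrightarrow> \<epsilon> j = - 1 \<or> \<epsilon> j = 1"
  by (auto simp: signs_def)

lemma sign_avg_const [simp]: "sign_avg m (\<lambda>_. c) = c"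
  by (simp add: sign_avg_def card_signs)

lemma sign_avg_mono: "(\<And>\<epsilon>. \<epsilon> \<in> signs m \<Longrightarrow> f \<epsilon> \<le> g \<epsilon>) \<Longrightarrow> sign_avg m f \<le> sign_avg m g"
  by (auto simp: sign_avg_def intro!: divide_right_mono sum_mono)

lemma sign_avg_add: "sign_avg m (\<lambda>\<epsilon>. f \<epsilon> + g \<epsilon>) = sign_avg m f + sign_avg m g"
  by (simp add: sign_avg_def sum.distrib add_divide_distrib)

lemma sign_avg_cmult: "sign_avg m (\<lambda>\<epsilon>. c * f \<epsilon>) = c * sign_avg m f"
  by (simp add: sign_avg_def sum_distrib_left)

lemma sign_avg_sum: "sign_avg m (\<lambda>\<epsilon>. \<Sum>i\<in>I. f i \<epsilon>) = (\<Sum>i\<in>I. sign_avg m (f i))"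
  unfolding sign_avg_def by (subst sum.swap) (simp add: sum_divide_distrib)

text \<open>Independence of the signs appears as distributivity: the sum over sign vectors of a
  product is the product of the factors \<open>2 * cosh (a j)\<close>.\<close>

lemma sign_avg_exp_le:
  "sign_avg m (\<lambda>\<epsilon>. exp (\<Sum>j<m. \<epsilon> j * a j)) \<le> exp ((\<Sum>j<m. (a j)\<^sup>2) / 2)"
proof -
  have "(\<Sum>\<epsilon>\<in>signs m. exp (\<Sum>j<m. \<epsilon> j * a j)) = (\<Prod>j<m. \<Sum>s\<in>{-1, 1}. exp (s * a j))"
    by (simp add: signs_def exp_sum prod_sum_PiE del: sum.insert)
  also have "\<dots> = (\<Prod>j<m. 2 * cosh (a j))"
    by (intro prod.cong) (auto simp: cosh_field_def)
  finally have "sign_avg m (\<lambda>\<epsilon>. exp (\<Sum>j<m. \<epsilon> j * a j)) = (\<Prod>j<m. cosh (a j))"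
    by (simp add: sign_avg_def prod.distrib)
  also have "\<dots> \<le> (\<Prod>j<m. exp ((a j)\<^sup>2 / 2))"
    by (intro prod_mono) (simp add: cosh_le_exp_half_square)
  finally show ?thesis
    by (simp add: exp_sum sum_divide_distrib)
qed

text \<open>Massart's maximal inequality before optimization in \<open>l\<close>: the maximum is
  dominated by exponential moments summed over \<open>T\<close> and both signs. Leaving
  \<open>l\<close> free keeps the bound affine in \<open>V\<close>.\<close>

lemma sign_avg_Max_le:
  fixes a :: "'t \<Rightarrow> nat \<Rightarrow> real"
  assumes T: "finite T" "T \<noteq> {}" and card: "real (card T) \<le> n" and "l > 0"
    and V: "\<And>t. t \<in> T \<Longrightarrow> (\<Sum>j<m. (a t j)\<^sup>2) \<le> V"
  shows "sign_avg m (\<lambda>\<epsilon>. MAX t\<in>T. \<bar>\<Sum>j<m. \<epsilon> j * a t j\<bar>) \<le> ln (2 * n) / l + l * V / 2"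
proof -
  define X where "X \<epsilon> t = (\<Sum>j<m. \<epsilon> j * a t j)" for \<epsilon> t
  \<comment> \<open>An upper bound for the average of the sum of exponentials that dominates the
    maximum. The tangent of the logarithm at \<open>c\<close> then takes the place of Jensen's
    inequality.\<close>
  define c where "c = 2 * n * exp (l\<^sup>2 * V / 2)"
  have "card T \<ge> 1"
    using T by (simp add: Suc_leI card_gt_0_iff)
  then have n: "n > 0"
    using card by linarith
  then have c: "c > 0"
    by (simp add: c_def)
  have ptw: "l * (MAX t\<in>T. \<bar>X \<epsilon> t\<bar>)
      \<le> (ln c - 1) + (1 / c) * (\<Sum>t\<in>T. exp (l * X \<epsilon> t) + exp (- l * X \<epsilon> t))" for \<epsilon>
  proof -
    obtain t where t: "t \<in> T" "(MAX t\<in>T. \<bar>X \<epsilon> t\<bar>) = \<bar>X \<epsilon> t\<bar>"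
      using obtains_MAX[OF T] by metis
    define y where "y = l * \<bar>X \<epsilon> t\<bar>"
    have "exp y \<le> exp (l * X \<epsilon> t) + exp (- l * X \<epsilon> t)"
      by (cases "X \<epsilon> t \<ge> 0") (auto simp: y_def)
    also have "\<dots> \<le> (\<Sum>t\<in>T. exp (l * X \<epsilon> t) + exp (- l * X \<epsilon> t))"
      using t T by (intro member_le_sum[where f = "\<lambda>t. exp (l * X \<epsilon> t) + exp (- l * X \<epsilon> t)"])
        (auto intro: add_nonneg_nonneg)
    finally have "exp y / c \<le> (1 / c) * (\<Sum>t\<in>T. exp (l * X \<epsilon> t) + exp (- l * X \<epsilon> t))"
      using c by (simp add: divide_right_mono)
    moreover have "1 + (y - ln c) \<le> exp (y - ln c)"
      by (rule exp_ge_add_one_self)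
    then have "1 + (y - ln c) \<le> exp y / c"
      using c by (simp add: exp_diff)
    ultimately show ?thesis
      using t by (simp add: y_def)
  qed
  have mgf: "sign_avg m (\<lambda>\<epsilon>. exp (s * X \<epsilon> t)) \<le> exp (l\<^sup>2 * V / 2)"
    if "t \<in> T" "s\<^sup>2 = l\<^sup>2" for s t
  proof -
    have "sign_avg m (\<lambda>\<epsilon>. exp (s * X \<epsilon> t)) \<le> exp ((\<Sum>j<m. (s * a t j)\<^sup>2) / 2)"
      using sign_avg_exp_le[of m "\<lambda>j. s * a t j"]
      by (simp add: X_def sum_distrib_left mult.left_commute)
    also have "(\<Sum>j<m. (s * a t j)\<^sup>2) = l\<^sup>2 * (\<Sum>j<m. (a t j)\<^sup>2)"
      using that(2) by (simp add: power_mult_distrib sum_distrib_left)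
    also have "exp (l\<^sup>2 * (\<Sum>j<m. (a t j)\<^sup>2) / 2) \<le> exp (l\<^sup>2 * V / 2)"
      using V[OF that(1)] by (simp add: mult_left_mono)
    finally show ?thesis .
  qed
  have "sign_avg m (\<lambda>\<epsilon>. l * (MAX t\<in>T. \<bar>X \<epsilon> t\<bar>)) \<le> sign_avg m (\<lambda>\<epsilon>. (ln c - 1)
      + (1 / c) * (\<Sum>t\<in>T. exp (l * X \<epsilon> t) + exp (- l * X \<epsilon> t)))"
    by (rule sign_avg_mono) (rule ptw)
  then have "l * sign_avg m (\<lambda>\<epsilon>. MAX t\<in>T. \<bar>X \<epsilon> t\<bar>)
      \<le> (ln c - 1) + (1 / c) * (\<Sum>t\<in>T. sign_avg m (\<lambda>\<epsilon>. exp (l * X \<epsilon> t)) + sign_avg m (\<lambda>\<epsilon>. exp (- l * X \<epsilon> t)))"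
    by (simp only: sign_avg_cmult sign_avg_add sign_avg_sum sign_avg_const)
  also have "\<dots> \<le> (ln c - 1) + (1 / c) * (\<Sum>t\<in>T. 2 * exp (l\<^sup>2 * V / 2))"
  proof -
    have "sign_avg m (\<lambda>\<epsilon>. exp (l * X \<epsilon> t)) + sign_avg m (\<lambda>\<epsilon>. exp (- l * X \<epsilon> t))
        \<le> 2 * exp (l\<^sup>2 * V / 2)" if "t \<in> T" for t
      using mgf[OF that, of l] mgf[OF that, of "- l"] by simp
    from sum_mono[OF this] have "(\<Sum>t\<in>T. sign_avg m (\<lambda>\<epsilon>. exp (l * X \<epsilon> t)) + sign_avg m (\<lambda>\<epsilon>. exp (- l * X \<epsilon> t)))
        \<le> (\<Sum>t\<in>T. 2 * exp (l\<^sup>2 * V / 2))" .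
    from mult_left_mono[OF this, of "1 / c"] show ?thesis
      using c by (simp only: add_le_cancel_left divide_nonneg_pos zero_le_one less_imp_le)
  qed
  also have "\<dots> \<le> (ln c - 1) + (1 / c) * c"
  proof -
    have "(\<Sum>t\<in>T. 2 * exp (l\<^sup>2 * V / 2)) \<le> c"
      using mult_right_mono[OF card, of "2 * exp (l\<^sup>2 * V / 2)"] by (simp add: c_def mult.commute mult.left_commute)
    from mult_left_mono[OF this, of "1 / c"] show ?thesis
      using c by (simp only: add_le_cancel_left divide_nonneg_pos zero_le_one less_imp_le)
  qed
  also have "\<dots> = ln (2 * n) + l\<^sup>2 * V / 2"
  proof -
    have "ln c = ln (2 * n) + l\<^sup>2 * V / 2"
      unfolding c_def using n by (subst ln_mult) auto
    then show ?thesis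
      using c by simp
  qed
  finally have "sign_avg m (\<lambda>\<epsilon>. MAX t\<in>T. \<bar>X \<epsilon> t\<bar>) \<le> (ln (2 * n) + l\<^sup>2 * V / 2) / l"
    using \<open>l > 0\<close> by (simp add: pos_le_divide_eq mult.commute)
  also have "\<dots> = ln (2 * n) / l + l * V / 2"
    using \<open>l > 0\<close> by (simp add: add_divide_distrib power2_eq_square)
  finally show ?thesis
    by (simp add: X_def)
qed

lemma Nn_pos: "Nn k > 0"
  by (simp add: Nn_def)

text \<open>The product bounds the number of links between two consecutive nets, and the factor 2
  counts the two signs of the absolute value in \<open>sign_avg_Max_le\<close>.\<close>

lemma ln_Nn_le: "ln (2 * (real (Nn (Suc k)) * real (Nn k))) \<le> 2 * 2 ^ Suc k"
proof -
  \<comment> \<open>The case distinction reflects \<open>Nn 0 = 1\<close>, where the general formula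
    would give 2.\<close>
  have "1 + 2 ^ Suc k + (if k = 0 then 0 else 2 ^ k) \<le> (2 :: nat) * 2 ^ Suc k"
    by (cases k) auto
  then have "(2::nat) ^ (1 + 2 ^ Suc k + (if k = 0 then 0 else 2 ^ k)) \<le> 2 ^ (2 * 2 ^ Suc k)"
    by (rule power_increasing) simp
  then have "2 * (Nn (Suc k) * Nn k) \<le> 2 ^ (2 * 2 ^ Suc k)"
    by (simp add: Nn_def power_add split: if_splits)
  then have "real (2 * (Nn (Suc k) * Nn k)) \<le> real (2 ^ (2 * 2 ^ Suc k))"
    by (rule of_nat_mono)
  then have "2 * (real (Nn (Suc k)) * real (Nn k)) \<le> 2 ^ (2 * 2 ^ Suc k)"
    by (simp only: of_nat_mult of_nat_power of_nat_numeral)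
  then have "ln (2 * (real (Nn (Suc k)) * real (Nn k))) \<le> ln (2 ^ (2 * 2 ^ Suc k))"
    by (subst ln_le_cancel_iff) (auto simp: Nn_pos)
  also have "\<dots> = 2 * 2 ^ Suc k * ln 2"
    by (simp add: ln_realpow)
  also have "\<dots> \<le> 2 * 2 ^ Suc k * 1"
    using ln_2_less_1 by (intro mult_left_mono) auto
  finally show ?thesis
    by simp
qed

text \<open>Each scale \<open>k\<close> uses its own exponential parameter, chosen independently of \<open>S\<close>. The
  bound is then affine in \<open>S\<close>, so that it can be integrated without Jensen's inequality.\<close>

lemma sign_avg_chaining:
  fixes a :: "'t \<Rightarrow> nat \<Rightarrow> real" and p :: "nat \<Rightarrow> 't \<Rightarrow> 't"
  assumes T: "finite T" "T \<noteq> {}" and "m > 0" and "S \<ge> 0"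
    and start: "\<And>t j. t \<in> T \<Longrightarrow> j < m \<Longrightarrow> a (p 0 t) j = 0"
    and stop: "\<And>t. t \<in> T \<Longrightarrow> p K t = t"
    and card: "\<And>k. k \<le> K \<Longrightarrow> card (p k ` T) \<le> Nn k"
    and c: "\<And>k. k < K \<Longrightarrow> c k > 0"
    and incr: "\<And>k t. k < K \<Longrightarrow> t \<in> T \<Longrightarrow>
      (\<Sum>j<m. (a (p (Suc k) t) j - a (p k t) j)\<^sup>2) \<le> (c k)\<^sup>2 * real m * S"
  shows "sign_avg m (\<lambda>\<epsilon>. MAX t\<in>T. \<bar>\<Sum>j<m. \<epsilon> j * a t j\<bar>)
    \<le> sqrt m * (\<Sum>k<K. sqrt (2 ^ Suc k) * c k) * (2 + S)"
proof -
  \<comment> \<open>The maximum at scale \<open>k\<close> runs over these links rather than over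
    \<open>T\<close>, so its size is controlled by the nets and not by
    \<open>card T\<close>.\<close>
  define L where "L k = (\<lambda>t. (p (Suc k) t, p k t)) ` T" for k
  define b where "b u j = a (fst u) j - a (snd u) j" for u :: "'t \<times> 't" and j
  have L: "finite (L k)" "L k \<noteq> {}" for k
    using T by (auto simp: L_def)
  have "card (L k) \<le> Nn (Suc k) * Nn k" if "k < K" for k
  proof -
    have "card (L k) \<le> card (p (Suc k) ` T \<times> p k ` T)"
      using T by (intro card_mono) (auto simp: L_def)
    also have "\<dots> \<le> Nn (Suc k) * Nn k"
      using card[of k] card[of "Suc k"] that by (simp add: card_cartesian_product mult_mono)
    finally show ?thesis .
  qed
  then have card_L: "real (card (L k)) \<le> real (Nn (Suc k)) * real (Nn k)" if "k < K" for k
    using that by (metis of_nat_le_iff of_nat_mult)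
  have link: "sign_avg m (\<lambda>\<epsilon>. MAX u\<in>L k. \<bar>\<Sum>j<m. \<epsilon> j * b u j\<bar>)
      \<le> sqrt m * (sqrt (2 ^ Suc k) * c k) * (2 + S)" if "k < K" for k
  proof -
    define r where "r = sqrt (2 ^ Suc k)"
    define s where "s = sqrt (real m)"
    have r: "r > 0" "2 ^ Suc k = r\<^sup>2" and s: "s > 0" "real m = s\<^sup>2"
      using \<open>m > 0\<close> by (auto simp: r_def s_def)
    have ck: "c k > 0"
      using c that .
    \<comment> \<open>With this choice the logarithmic term and the variance term are both multiples
      of \<open>s * (r * c k)\<close>, the scale \<open>k\<close> summand of Dudley's sum.\<close>
    define l where "l = r / (c k * s)"
    have l: "l > 0"
      using r s ck by (simp add: l_def)
    have "sign_avg m (\<lambda>\<epsilon>. MAX u\<in>L k. \<bar>\<Sum>j<m. \<epsilon> j * b u j\<bar>)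
        \<le> ln (2 * (real (Nn (Suc k)) * real (Nn k))) / l + l * ((c k)\<^sup>2 * real m * S) / 2"
      using L card_L[OF that] l incr[OF that]
      by (intro sign_avg_Max_le) (auto simp: L_def b_def)
    also have "\<dots> \<le> 2 * r\<^sup>2 / l + l * ((c k)\<^sup>2 * real m * S) / 2"
      using divide_right_mono[OF ln_Nn_le[of k], of l] l unfolding r(2) by simp
    also have "\<dots> = s * (r * c k) * (2 + S / 2)"
    proof -
      have E: "r\<^sup>2 / l = s * (r * c k)" "l * ((c k)\<^sup>2 * s\<^sup>2 * S) = s * (r * c k) * S"
        using r(1) s(1) ck by (simp_all add: l_def power2_eq_square)
      have "2 * r\<^sup>2 / l + l * ((c k)\<^sup>2 * s\<^sup>2 * S) / 2 = 2 * (r\<^sup>2 / l) + (l * ((c k)\<^sup>2 * s\<^sup>2 * S)) / 2"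
        by simp
      also have "\<dots> = s * (r * c k) * (2 + S / 2)"
        unfolding E by (simp add: distrib_left)
      finally show ?thesis
        unfolding s(2) .
    qed
    also have "\<dots> \<le> s * (r * c k) * (2 + S)"
      using r(1) s(1) ck \<open>S \<ge> 0\<close> by (intro mult_left_mono) auto
    finally show ?thesis
      by (simp add: r_def s_def)
  qed
  \<comment> \<open>Each \<open>a t\<close> telescopes along its chain from \<open>p 0 t\<close>,
    where the values vanish, to \<open>p K t = t\<close>. The maximum of the sum is then at most the
    sum of the maxima over links.\<close>
  have "(MAX t\<in>T. \<bar>\<Sum>j<m. \<epsilon> j * a t j\<bar>) \<le> (\<Sum>k<K. MAX u\<in>L k. \<bar>\<Sum>j<m. \<epsilon> j * b u j\<bar>)" for \<epsilon>
  proof (rule Max.boundedI; clarsimp?)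
    fix t assume t: "t \<in> T"
    have tele: "a (p K t) j - a (p 0 t) j = (\<Sum>k<K. a (p (Suc k) t) j - a (p k t) j)" for j
      using sum_lessThan_telescope[of "\<lambda>k. a (p k t) j" K] by (rule sym)
    have "(\<Sum>j<m. \<epsilon> j * a t j) = (\<Sum>j<m. \<epsilon> j * (a (p K t) j - a (p 0 t) j))"
      using start stop t by simp
    also have "\<dots> = (\<Sum>j<m. \<epsilon> j * (\<Sum>k<K. a (p (Suc k) t) j - a (p k t) j))"
      by (simp only: tele)
    also have "\<dots> = (\<Sum>k<K. \<Sum>j<m. \<epsilon> j * b (p (Suc k) t, p k t) j)"
      unfolding sum_distrib_left b_def fst_conv snd_conv by (rule sum.swap)
    finally have eq: "(\<Sum>j<m. \<epsilon> j * a t j) = (\<Sum>k<K. \<Sum>j<m. \<epsilon> j * b (p (Suc k) t, p k t) j)" .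
    have "\<bar>\<Sum>j<m. \<epsilon> j * a t j\<bar> \<le> (\<Sum>k<K. \<bar>\<Sum>j<m. \<epsilon> j * b (p (Suc k) t, p k t) j\<bar>)"
      unfolding eq by (rule sum_abs)
    also have "\<dots> \<le> (\<Sum>k<K. MAX u\<in>L k. \<bar>\<Sum>j<m. \<epsilon> j * b u j\<bar>)"
      using t L by (intro sum_mono Max_ge) (auto simp: L_def)
    finally show "\<bar>\<Sum>j<m. \<epsilon> j * a t j\<bar> \<le> (\<Sum>k<K. MAX u\<in>L k. \<bar>\<Sum>j<m. \<epsilon> j * b u j\<bar>)" .
  qed (use T in auto)
  then have "sign_avg m (\<lambda>\<epsilon>. MAX t\<in>T. \<bar>\<Sum>j<m. \<epsilon> j * a t j\<bar>)
      \<le> sign_avg m (\<lambda>\<epsilon>. \<Sum>k<K. MAX u\<in>L k. \<bar>\<Sum>j<m. \<epsilon> j * b u j\<bar>)"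
    by (rule sign_avg_mono)
  also have "\<dots> \<le> (\<Sum>k<K. sqrt m * (sqrt (2 ^ Suc k) * c k) * (2 + S))"
    unfolding sign_avg_sum using link by (intro sum_mono) auto
  finally show ?thesis
    by (simp add: sum_distrib_left sum_distrib_right)
qed

subsection \<open>Symmetrization\<close>

lemma Max_abs_add_le:
  fixes f g :: "'t \<Rightarrow> real"
  assumes T: "finite T" "T \<noteq> {}"
  shows "(MAX t\<in>T. \<bar>f t - g t\<bar>) \<le> (MAX t\<in>T. \<bar>f t\<bar>) + (MAX t\<in>T. \<bar>g t\<bar>)"
proof (rule Max.boundedI; clarsimp?)
  fix t assume t: "t \<in> T"
  have "\<bar>f t\<bar> \<le> (MAX t\<in>T. \<bar>f t\<bar>)" "\<bar>g t\<bar> \<le> (MAX t\<in>T. \<bar>g t\<bar>)"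
    using t T by (auto intro: Max_ge)
  then show "\<bar>f t - g t\<bar> \<le> (MAX t\<in>T. \<bar>f t\<bar>) + (MAX t\<in>T. \<bar>g t\<bar>)"
    by linarith
qed (use T in auto)

lemma integrable_Max_abs:
  fixes g :: "'t \<Rightarrow> 'a \<Rightarrow> real"
  assumes "prob_space M" and T: "finite T" "T \<noteq> {}"
    and meas: "\<And>t. t \<in> T \<Longrightarrow> g t \<in> borel_measurable M"
    and bd: "\<And>t x. t \<in> T \<Longrightarrow> x \<in> space M \<Longrightarrow> \<bar>g t x\<bar> \<le> C"
  shows "integrable M (\<lambda>x. MAX t\<in>T. \<bar>g t x\<bar>)"
proof -
  interpret prob_space M by fact
  show ?thesis
  proof (rule integrable_const_bound[of _ C])
    show "(\<lambda>x. MAX t\<in>T. \<bar>g t x\<bar>) \<in> borel_measurable M"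
      using T meas by (intro borel_measurable_Max) auto
    show "AE x in M. norm (MAX t\<in>T. \<bar>g t x\<bar>) \<le> C"
    proof (rule AE_I2)
      fix x assume x: "x \<in> space M"
      obtain t where "t \<in> T" "(MAX t\<in>T. \<bar>g t x\<bar>) = \<bar>g t x\<bar>"
        using obtains_MAX[OF T] by metis
      then show "norm (MAX t\<in>T. \<bar>g t x\<bar>) \<le> C"
        using bd[OF _ x] by simp
    qed
  qed
qed

text \<open>Picking coordinates along an injection preserves the law of an i.i.d. family.
  Projections onto a subsample and permutations of the coordinates are both of this kind.\<close>

lemma
  fixes F :: "('i \<Rightarrow> 'a) \<Rightarrow> real"
  assumes M: "prob_space M" and f: "inj_on f I" "f \<in> I \<rightarrow> K"
    and F: "integrable (PiM I (\<lambda>_. M)) F"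
  shows integrable_PiM_reindex: "integrable (PiM K (\<lambda>_. M)) (\<lambda>\<omega>. F (\<lambda>n\<in>I. \<omega> (f n)))"
    and integral_PiM_reindex:
      "(\<integral>\<omega>. F (\<lambda>n\<in>I. \<omega> (f n)) \<partial>PiM K (\<lambda>_. M)) = (\<integral>\<omega>. F \<omega> \<partial>PiM I (\<lambda>_. M))"
proof -
  have meas: "(\<lambda>\<omega>. \<lambda>n\<in>I. \<omega> (f n)) \<in> measurable (PiM K (\<lambda>_. M)) (PiM I (\<lambda>_. M))"
    using f(2) by (intro measurable_restrict) (auto intro!: measurable_component_singleton)
  have distr: "distr (PiM K (\<lambda>_. M)) (PiM I (\<lambda>_. M)) (\<lambda>\<omega>. \<lambda>n\<in>I. \<omega> (f n)) = PiM I (\<lambda>_. M)"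
    using distr_PiM_reindex[where M = "\<lambda>_. M", OF M f] .
  show "integrable (PiM K (\<lambda>_. M)) (\<lambda>\<omega>. F (\<lambda>n\<in>I. \<omega> (f n)))"
    using meas by (rule integrable_distr) (simp only: distr F)
  show "(\<integral>\<omega>. F (\<lambda>n\<in>I. \<omega> (f n)) \<partial>PiM K (\<lambda>_. M)) = (\<integral>\<omega>. F \<omega> \<partial>PiM I (\<lambda>_. M))"
    using integral_distr[OF meas borel_measurable_integrable[OF F]] by (simp only: distr)
qed

text \<open>The ghost sample occupies the coordinates \<open>m..<2*m\<close>, so that the sign changes and the
  marginals are all instances of reindexing a product measure.\<close>

lemma symmetrization:
  fixes h :: "'t \<Rightarrow> 'a \<Rightarrow> real"
  assumes "prob_space M" and T: "finite T" "T \<noteq> {}"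
    and meas: "\<And>t. t \<in> T \<Longrightarrow> h t \<in> borel_measurable M"
    and bd: "\<And>t x. t \<in> T \<Longrightarrow> x \<in> space M \<Longrightarrow> \<bar>h t x\<bar> \<le> H"
  shows "(\<integral>\<xi>. (MAX t\<in>T. \<bar>(\<Sum>j<m. h t (\<xi> j)) - real m * (\<integral>x. h t x \<partial>M)\<bar>) \<partial>PiM {..<m} (\<lambda>_. M))
    \<le> 2 * (\<integral>\<xi>. sign_avg m (\<lambda>\<epsilon>. MAX t\<in>T. \<bar>\<Sum>j<m. \<epsilon> j * h t (\<xi> j)\<bar>) \<partial>PiM {..<m} (\<lambda>_. M))"
    (is "?lhs \<le> 2 * ?rhs")
proof -
  interpret M: prob_space M by fact
  interpret PS: product_sigma_finite "\<lambda>_::nat. M" by standard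
  define P where "P = PiM {..<m} (\<lambda>_. M)"
  define Q where "Q = PiM {..<2 * m} (\<lambda>_. M)"
  define R where "R = PiM {m..<2 * m} (\<lambda>_. M)"
  interpret P: prob_space P unfolding P_def by (intro prob_space_PiM M.prob_space_axioms)
  interpret Q: prob_space Q unfolding Q_def by (intro prob_space_PiM M.prob_space_axioms)
  interpret R: prob_space R unfolding R_def by (intro prob_space_PiM M.prob_space_axioms)
  have comp: "(\<lambda>\<omega>. h t (\<omega> j)) \<in> borel_measurable (PiM I (\<lambda>_. M))" if "t \<in> T" "j \<in> I" for t j I
    using measurable_compose[OF measurable_component_singleton[OF that(2)] meas[OF that(1)]] .
  have in_space: "\<omega> j \<in> space M" if "\<omega> \<in> space (PiM I (\<lambda>_. M))" "j \<in> I" for \<omega> j and I :: "nat set"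
    using that by (auto simp: space_PiM)
  have H: "\<bar>h t (\<omega> j)\<bar> \<le> H" if "t \<in> T" "\<omega> \<in> space (PiM I (\<lambda>_. M))" "j \<in> I" for t \<omega> j and I :: "nat set"
    using bd[OF that(1) in_space[OF that(2,3)]] .
  have sgn: "\<bar>\<epsilon> j * y\<bar> \<le> H" if "\<epsilon> \<in> signs m" "j < m" "\<bar>y\<bar> \<le> H" for \<epsilon> j y
    using signs_cases[OF that(1,2)] that(3) by auto
  define D where "D \<omega> t j = h t (\<omega> j) - h t (\<omega> (m + j))" for \<omega> t j
  have ones: "(\<lambda>j\<in>{..<m}. 1) \<in> signs m"
    by (auto simp: signs_def)
  have sum_bd: "\<bar>\<Sum>j<m. f j\<bar> \<le> real m * C" if "\<And>j. j < m \<Longrightarrow> \<bar>f j\<bar> \<le> C" for f C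
  proof -
    have "\<bar>\<Sum>j<m. f j\<bar> \<le> (\<Sum>j<m. \<bar>f j\<bar>)"
      by (rule sum_abs)
    also have "\<dots> \<le> real (card {..<m}) * C"
      using that by (intro sum_bounded_above) auto
    finally show ?thesis
      by simp
  qed
  define G where "G \<epsilon> \<omega> = (MAX t\<in>T. \<bar>\<Sum>j<m. \<epsilon> j * D \<omega> t j\<bar>)" for \<epsilon> \<omega>
  define E where "E \<epsilon> \<xi> = (MAX t\<in>T. \<bar>\<Sum>j<m. \<epsilon> j * h t (\<xi> j)\<bar>)" for \<epsilon> \<xi>
  have G_int: "integrable Q (G \<epsilon>)" if \<epsilon>: "\<epsilon> \<in> signs m" for \<epsilon>
    unfolding G_def
  proof (rule integrable_Max_abs[OF Q.prob_space_axioms T])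
    show "(\<lambda>\<omega>. \<Sum>j<m. \<epsilon> j * D \<omega> t j) \<in> borel_measurable Q" if "t \<in> T" for t
      unfolding D_def Q_def using that
      by (intro borel_measurable_sum borel_measurable_times borel_measurable_diff comp) auto
    fix t \<omega> assume t: "t \<in> T" and \<omega>: "\<omega> \<in> space Q"
    have "\<bar>\<epsilon> j * D \<omega> t j\<bar> \<le> 2 * H" if "j < m" for j
      using H[OF t, of \<omega> "{..<2 * m}" j] H[OF t, of \<omega> "{..<2 * m}" "m + j"] \<omega> that signs_cases[OF \<epsilon> that]
      by (auto simp: D_def Q_def)
    then show "\<bar>\<Sum>j<m. \<epsilon> j * D \<omega> t j\<bar> \<le> real m * (2 * H)"
      by (rule sum_bd)
  qed
  have E_int: "integrable P (E \<epsilon>)" if \<epsilon>: "\<epsilon> \<in> signs m" for \<epsilon>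
    unfolding E_def
  proof (rule integrable_Max_abs[OF P.prob_space_axioms T])
    show "(\<lambda>\<omega>. \<Sum>j<m. \<epsilon> j * h t (\<omega> j)) \<in> borel_measurable P" if "t \<in> T" for t
      unfolding P_def using that
      by (intro borel_measurable_sum borel_measurable_times comp) auto
    show "\<bar>\<Sum>j<m. \<epsilon> j * h t (\<omega> j)\<bar> \<le> real m * H" if "t \<in> T" "\<omega> \<in> space P" for t \<omega>
      using H[OF that(1), of \<omega> "{..<m}"] that sgn[OF \<epsilon>] by (intro sum_bd) (auto simp: P_def)
  qed
  have int_fst: "integrable Q (\<lambda>\<omega>. E \<epsilon> (\<lambda>n\<in>{..<m}. \<omega> n))"
    "(\<integral>\<omega>. E \<epsilon> (\<lambda>n\<in>{..<m}. \<omega> n) \<partial>Q) = (\<integral>\<xi>. E \<epsilon> \<xi> \<partial>P)" if \<epsilon>: "\<epsilon> \<in> signs m" for \<epsilon>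
    using integrable_PiM_reindex[OF \<open>prob_space M\<close>, of "\<lambda>n. n" "{..<m}" "{..<2 * m}" "E \<epsilon>"]
      integral_PiM_reindex[OF \<open>prob_space M\<close>, of "\<lambda>n. n" "{..<m}" "{..<2 * m}" "E \<epsilon>"] E_int[OF \<epsilon>]
    by (auto simp: P_def Q_def)
  have int_snd: "integrable Q (\<lambda>\<omega>. E \<epsilon> (\<lambda>n\<in>{..<m}. \<omega> (m + n)))"
    "(\<integral>\<omega>. E \<epsilon> (\<lambda>n\<in>{..<m}. \<omega> (m + n)) \<partial>Q) = (\<integral>\<xi>. E \<epsilon> \<xi> \<partial>P)" if \<epsilon>: "\<epsilon> \<in> signs m" for \<epsilon>
    using integrable_PiM_reindex[OF \<open>prob_space M\<close>, of "\<lambda>n. m + n" "{..<m}" "{..<2 * m}" "E \<epsilon>"]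
      integral_PiM_reindex[OF \<open>prob_space M\<close>, of "\<lambda>n. m + n" "{..<m}" "{..<2 * m}" "E \<epsilon>"] E_int[OF \<epsilon>]
    by (auto simp: P_def Q_def)
  have swap: "(\<integral>\<omega>. G \<epsilon> \<omega> \<partial>Q) = (\<integral>\<omega>. G (\<lambda>j\<in>{..<m}. 1) \<omega> \<partial>Q)" if \<epsilon>: "\<epsilon> \<in> signs m" for \<epsilon>
  proof -
    \<comment> \<open>The involution that exchanges coordinate \<open>n\<close> with its ghost
      \<open>m + n\<close> wherever the sign is -1. Reindexing by it multiplies each difference by
      its sign and preserves the measure.\<close>
    define f where "f n = (if n < m then (if \<epsilon> n = 1 then n else m + n)
      else (if \<epsilon> (n - m) = 1 then n else n - m))" for n
    have invol: "f (f n) = n" if "n < 2 * m" for n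
      using that by (auto simp: f_def)
    then have inj: "inj_on f {..<2 * m}"
      by (metis inj_on_def lessThan_iff)
    have range: "f \<in> {..<2 * m} \<rightarrow> {..<2 * m}"
      by (auto simp: f_def)
    have "G (\<lambda>j\<in>{..<m}. 1) (\<lambda>n\<in>{..<2 * m}. \<omega> (f n)) = G \<epsilon> \<omega>" for \<omega>
    proof -
      have "\<epsilon> j * D \<omega> t j = D (\<lambda>n\<in>{..<2 * m}. \<omega> (f n)) t j" if "j < m" for t j
        using signs_cases[OF \<epsilon> that] that by (auto simp: D_def f_def)
      then show ?thesis
        by (simp add: G_def)
    qed
    then show ?thesis
      using integral_PiM_reindex[OF \<open>prob_space M\<close> inj range, of "G (\<lambda>j\<in>{..<m}. 1)"] G_int[OF ones]
      by (simp add: Q_def)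
  qed
  have G_le: "G \<epsilon> \<omega> \<le> E \<epsilon> (\<lambda>n\<in>{..<m}. \<omega> n) + E \<epsilon> (\<lambda>n\<in>{..<m}. \<omega> (m + n))" for \<epsilon> \<omega>
    using Max_abs_add_le[OF T, of "\<lambda>t. \<Sum>j<m. \<epsilon> j * h t (\<omega> j)" "\<lambda>t. \<Sum>j<m. \<epsilon> j * h t (\<omega> (m + j))"]
    by (simp add: G_def E_def D_def right_diff_distrib sum_subtractf)
  have "(\<integral>\<omega>. G \<epsilon> \<omega> \<partial>Q) \<le> 2 * (\<integral>\<xi>. E \<epsilon> \<xi> \<partial>P)" if \<epsilon>: "\<epsilon> \<in> signs m" for \<epsilon>
  proof -
    have "(\<integral>\<omega>. G \<epsilon> \<omega> \<partial>Q)
        \<le> (\<integral>\<omega>. E \<epsilon> (\<lambda>n\<in>{..<m}. \<omega> n) + E \<epsilon> (\<lambda>n\<in>{..<m}. \<omega> (m + n)) \<partial>Q)"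
      using \<epsilon> G_le by (intro integral_mono G_int Bochner_Integration.integrable_add int_fst int_snd) auto
    also have "\<dots> = 2 * (\<integral>\<xi>. E \<epsilon> \<xi> \<partial>P)"
      using \<epsilon> by (subst Bochner_Integration.integral_add) (auto simp: int_fst int_snd)
    finally show ?thesis .
  qed
  then have "sign_avg m (\<lambda>\<epsilon>. \<integral>\<omega>. G (\<lambda>j\<in>{..<m}. 1) \<omega> \<partial>Q) \<le> sign_avg m (\<lambda>\<epsilon>. 2 * (\<integral>\<xi>. E \<epsilon> \<xi> \<partial>P))"
    using swap by (intro sign_avg_mono) simp
  then have "(\<integral>\<omega>. G (\<lambda>j\<in>{..<m}. 1) \<omega> \<partial>Q) \<le> 2 * sign_avg m (\<lambda>\<epsilon>. \<integral>\<xi>. E \<epsilon> \<xi> \<partial>P)"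
    by (simp add: sign_avg_cmult)
  also have "sign_avg m (\<lambda>\<epsilon>. \<integral>\<xi>. E \<epsilon> \<xi> \<partial>P) = (\<integral>\<xi>. sign_avg m (\<lambda>\<epsilon>. E \<epsilon> \<xi>) \<partial>P)"
    using E_int by (simp add: sign_avg_def)
  finally have right: "(\<integral>\<omega>. G (\<lambda>j\<in>{..<m}. 1) \<omega> \<partial>Q) \<le> 2 * ?rhs"
    by (simp only: E_def P_def)

  have disj: "{..<m} \<inter> {m..<2 * m} = {}"
    by auto
  have Q_un: "Q = PiM ({..<m} \<union> {m..<2 * m}) (\<lambda>_. M)"
    unfolding Q_def by (rule arg_cong[where f = "\<lambda>I. PiM I (\<lambda>_. M)"]) auto
  have comp_int: "integrable R (\<lambda>y. h t (y j))" "(\<integral>y. h t (y j) \<partial>R) = (\<integral>x. h t x \<partial>M)"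
    if "t \<in> T" "j \<in> {m..<2 * m}" for t j
  proof -
    show "integrable R (\<lambda>y. h t (y j))"
      using H[OF that(1) _ that(2)] comp[OF that]
      by (intro R.integrable_const_bound[of _ H]) (auto simp: R_def)
    have "(\<integral>x. h t x \<partial>M) = (\<integral>x. h t x \<partial>distr R M (\<lambda>\<omega>. \<omega> j))"
      unfolding R_def using \<open>prob_space M\<close> that(2) by (subst distr_PiM_component[where M = "\<lambda>_. M"]) auto
    also have "\<dots> = (\<integral>y. h t (y j) \<partial>R)"
      unfolding R_def using that by (intro integral_distr meas measurable_component_singleton)
    finally show "(\<integral>y. h t (y j) \<partial>R) = (\<integral>x. h t x \<partial>M)" ..
  qed
  \<comment> \<open>The unsigned \<open>G\<close> with sample and ghost sample as separate
    arguments, in the form needed for Fubini.\<close>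
  define G' where "G' x y = (MAX t\<in>T. \<bar>(\<Sum>j<m. h t (x j)) - (\<Sum>j<m. h t (y (m + j)))\<bar>)" for x y
  have G_merge: "G (\<lambda>j\<in>{..<m}. 1) (merge {..<m} {m..<2 * m} (x, y)) = G' x y" for x y
    by (simp add: G_def G'_def D_def merge_def sum_subtractf)
  have G'_int: "integrable R (G' x)" if x: "x \<in> space P" for x
    unfolding G'_def
  proof (rule integrable_Max_abs[OF R.prob_space_axioms T])
    fix t assume t: "t \<in> T"
    show "(\<lambda>y. (\<Sum>j<m. h t (x j)) - (\<Sum>j<m. h t (y (m + j)))) \<in> borel_measurable R"
      unfolding R_def using t by (intro borel_measurable_diff borel_measurable_const borel_measurable_sum comp) auto
    fix y assume y: "y \<in> space R"
    have "\<bar>\<Sum>j<m. h t (x j)\<bar> \<le> real m * H"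
      using H[OF t, of x "{..<m}"] x by (intro sum_bd) (auto simp: P_def)
    moreover have "\<bar>\<Sum>j<m. h t (y (m + j))\<bar> \<le> real m * H"
      using H[OF t, of y "{m..<2 * m}"] y by (intro sum_bd) (auto simp: R_def)
    ultimately show "\<bar>(\<Sum>j<m. h t (x j)) - (\<Sum>j<m. h t (y (m + j)))\<bar> \<le> 2 * (real m * H)"
      by linarith
  qed
  \<comment> \<open>For a fixed sample \<open>x\<close>, the centring term is the expectation of the
    ghost sum. Moving the absolute value and then the maximum inside the ghost integral gives the
    bound.\<close>
  have inner: "(MAX t\<in>T. \<bar>(\<Sum>j<m. h t (x j)) - real m * (\<integral>x. h t x \<partial>M)\<bar>) \<le> (\<integral>y. G' x y \<partial>R)"
    if x: "x \<in> space P" for x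
  proof (rule Max.boundedI; clarsimp?)
    fix t assume t: "t \<in> T"
    have ci: "integrable R (\<lambda>y. \<Sum>j<m. h t (y (m + j)))"
      using t by (intro Bochner_Integration.integrable_sum comp_int) auto
    have "(\<integral>y. (\<Sum>j<m. h t (x j)) - (\<Sum>j<m. h t (y (m + j))) \<partial>R)
        = (\<Sum>j<m. h t (x j)) - real m * (\<integral>x. h t x \<partial>M)"
      using t ci by (subst Bochner_Integration.integral_diff)
        (auto simp: R.prob_space Bochner_Integration.integral_sum comp_int)
    then have "\<bar>(\<Sum>j<m. h t (x j)) - real m * (\<integral>x. h t x \<partial>M)\<bar>
        \<le> (\<integral>y. \<bar>(\<Sum>j<m. h t (x j)) - (\<Sum>j<m. h t (y (m + j)))\<bar> \<partial>R)"
      by (metis integral_abs_bound)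
    also have "\<dots> \<le> (\<integral>y. G' x y \<partial>R)"
      using t T ci x by (intro integral_mono integrable_abs Bochner_Integration.integrable_diff G'_int)
        (auto simp: G'_def intro!: Max_ge)
    finally show "\<bar>(\<Sum>j<m. h t (x j)) - real m * (\<integral>x. h t x \<partial>M)\<bar> \<le> (\<integral>y. G' x y \<partial>R)" .
  qed (use T in auto)
  have fold: "(\<integral>\<omega>. G (\<lambda>j\<in>{..<m}. 1) \<omega> \<partial>Q) = (\<integral>x. (\<integral>y. G' x y \<partial>R) \<partial>P)"
    using PS.product_integral_fold[OF disj, of "G (\<lambda>j\<in>{..<m}. 1)"] G_int[OF ones]
    by (auto simp: Q_un G_merge P_def R_def)
  have int_inner: "integrable P (\<lambda>x. \<integral>y. G' x y \<partial>R)"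
  proof -
    interpret PR: pair_sigma_finite P R ..
    have "integrable (P \<Otimes>\<^sub>M R) (\<lambda>z. G (\<lambda>j\<in>{..<m}. 1) (merge {..<m} {m..<2 * m} z))"
      unfolding P_def R_def
      by (rule integrable_distr[OF measurable_merge])
        (subst PS.distr_merge[OF disj], simp, simp, rule G_int[OF ones, unfolded Q_un])
    from PR.integrable_fst'[OF this] show ?thesis
      by (simp add: G_merge)
  qed
  have int_Max: "integrable P (\<lambda>x. MAX t\<in>T. \<bar>(\<Sum>j<m. h t (x j)) - real m * (\<integral>x. h t x \<partial>M)\<bar>)"
  proof (rule integrable_Max_abs[OF P.prob_space_axioms T])
    fix t assume t: "t \<in> T"
    show "(\<lambda>x. (\<Sum>j<m. h t (x j)) - real m * (\<integral>x. h t x \<partial>M)) \<in> borel_measurable P"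
      unfolding P_def using t
      by (intro borel_measurable_diff borel_measurable_const borel_measurable_sum comp) auto
    fix x assume x: "x \<in> space P"
    have "\<bar>\<Sum>j<m. h t (x j)\<bar> \<le> real m * H"
      using H[OF t, of x "{..<m}"] x by (intro sum_bd) (auto simp: P_def)
    moreover have "\<bar>real m * (\<integral>x. h t x \<partial>M)\<bar> \<le> (MAX t\<in>T. \<bar>real m * (\<integral>x. h t x \<partial>M)\<bar>)"
      using t T by (intro Max_ge) auto
    ultimately show "\<bar>(\<Sum>j<m. h t (x j)) - real m * (\<integral>x. h t x \<partial>M)\<bar>
        \<le> real m * H + (MAX t\<in>T. \<bar>real m * (\<integral>x. h t x \<partial>M)\<bar>)"
      by linarith
  qed
  have "?lhs \<le> (\<integral>\<omega>. G (\<lambda>j\<in>{..<m}. 1) \<omega> \<partial>Q)"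
    unfolding fold P_def[symmetric] using int_Max int_inner inner by (rule integral_mono)
  with right show ?thesis
    by linarith
qed

subsection \<open>Powers and entropy bounds\<close>

text \<open>The mean value theorem between the two absolute values, followed by the reverse triangle
  inequality.\<close>

lemma abs_powr_diff_le:
  fixes a b q :: real
  assumes "q \<ge> 1"
  shows "\<bar>\<bar>a\<bar> powr q - \<bar>b\<bar> powr q\<bar> \<le> q * \<bar>a - b\<bar> * max \<bar>a\<bar> \<bar>b\<bar> powr (q - 1)"
proof -
  have le: "x powr q - y powr q \<le> q * (x - y) * x powr (q - 1)" if "0 \<le> y" "y \<le> x" for x y :: real
  proof -
    \<comment> \<open>The derivative rule for \<open>powr\<close> requires a positive base, so the
      endpoint 0 is treated apart.\<close>
    consider "y = x" | "y = 0" "y < x" | "0 < y" "y < x"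
      using \<open>0 \<le> y\<close> \<open>y \<le> x\<close> by linarith
    then show ?thesis
    proof cases
      case 2
      then have "x powr q = x * x powr (q - 1)"
        by (simp add: powr_mult_base)
      then show ?thesis
        using 2 \<open>q \<ge> 1\<close> by (simp add: mult_right_mono mult.assoc)
    next
      case 3
      have "\<exists>z>y. z < x \<and> x powr q - y powr q = (x - y) * (q * z powr (q - 1))"
        using 3 by (intro MVT2) (auto intro!: has_real_derivative_powr)
      then obtain z where z: "y < z" "z < x" "x powr q - y powr q = (x - y) * (q * z powr (q - 1))"
        by blast
      have "z powr (q - 1) \<le> x powr (q - 1)"
        using z 3 \<open>q \<ge> 1\<close> by (intro powr_mono2) auto
      then have "(x - y) * (q * z powr (q - 1)) \<le> (x - y) * (q * x powr (q - 1))"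
        using 3 \<open>q \<ge> 1\<close> by (intro mult_left_mono) auto
      then show ?thesis
        using z by (simp add: mult.assoc mult.left_commute)
    qed simp
  qed
  have mono: "y powr q \<le> x powr q" if "0 \<le> y" "y \<le> x" for x y :: real
    using that \<open>q \<ge> 1\<close> by (intro powr_mono2) auto
  show ?thesis
  proof (cases "\<bar>b\<bar> \<le> \<bar>a\<bar>")
    case True
    have "\<bar>\<bar>a\<bar> powr q - \<bar>b\<bar> powr q\<bar> \<le> q * (\<bar>a\<bar> - \<bar>b\<bar>) * \<bar>a\<bar> powr (q - 1)"
      using le[of "\<bar>b\<bar>" "\<bar>a\<bar>"] mono[of "\<bar>b\<bar>" "\<bar>a\<bar>"] True by simp
    also have "\<dots> \<le> q * \<bar>a - b\<bar> * \<bar>a\<bar> powr (q - 1)"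
      using \<open>q \<ge> 1\<close> by (intro mult_right_mono mult_left_mono) auto
    finally show ?thesis
      using True by (simp add: max_absorb1)
  next
    case False
    have "\<bar>\<bar>a\<bar> powr q - \<bar>b\<bar> powr q\<bar> \<le> q * (\<bar>b\<bar> - \<bar>a\<bar>) * \<bar>b\<bar> powr (q - 1)"
      using le[of "\<bar>a\<bar>" "\<bar>b\<bar>"] mono[of "\<bar>a\<bar>" "\<bar>b\<bar>"] False by simp
    also have "\<dots> \<le> q * \<bar>a - b\<bar> * \<bar>b\<bar> powr (q - 1)"
      using \<open>q \<ge> 1\<close> by (intro mult_right_mono mult_left_mono) auto
    finally show ?thesis
      using False by (simp add: max_absorb2)
  qed
qed

lemma abs_powr_diff_le_bounded:
  fixes a b q :: real
  assumes "q \<ge> 1" "\<bar>a\<bar> \<le> R" "\<bar>b\<bar> \<le> R" "\<bar>a - b\<bar> \<le> \<delta>"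
  shows "\<bar>\<bar>a\<bar> powr q - \<bar>b\<bar> powr q\<bar> \<le> q * \<delta> * R powr (q - 1)"
proof -
  have "q * \<bar>a - b\<bar> * max \<bar>a\<bar> \<bar>b\<bar> powr (q - 1) \<le> q * \<delta> * R powr (q - 1)"
    using assms by (intro mult_mono powr_mono2) auto
  with abs_powr_diff_le[OF \<open>q \<ge> 1\<close>, of a b] show ?thesis
    by linarith
qed

text \<open>Squaring the difference bound produces the exponent 2(q - 1) = (q - 2) + q. Only the
  first part is estimated by \<open>R\<close>; the remaining power \<open>q\<close> is kept, because
  summed over the sample it reproduces the quantity being controlled.\<close>

lemma abs_powr_diff_sq_le:
  fixes a b q :: real
  assumes "q \<ge> 2" "\<bar>a\<bar> \<le> R" "\<bar>b\<bar> \<le> R" "\<bar>a - b\<bar> \<le> \<delta>"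
  shows "(\<bar>a\<bar> powr q - \<bar>b\<bar> powr q)\<^sup>2 \<le> q\<^sup>2 * \<delta>\<^sup>2 * R powr (q - 2) * (\<bar>a\<bar> powr q + \<bar>b\<bar> powr q)"
proof -
  define x where "x = max \<bar>a\<bar> \<bar>b\<bar>"
  have x: "0 \<le> x" "x \<le> R" "x powr q \<le> \<bar>a\<bar> powr q + \<bar>b\<bar> powr q"
    using assms by (auto simp: x_def max_def)
  have "\<bar>\<bar>a\<bar> powr q - \<bar>b\<bar> powr q\<bar> \<le> q * \<bar>a - b\<bar> * x powr (q - 1)"
    using abs_powr_diff_le[of q a b] assms by (simp add: x_def)
  then have "\<bar>\<bar>a\<bar> powr q - \<bar>b\<bar> powr q\<bar>\<^sup>2 \<le> (q * \<bar>a - b\<bar> * x powr (q - 1))\<^sup>2"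
    by (rule power_mono) simp
  also have "\<dots> = q\<^sup>2 * \<bar>a - b\<bar>\<^sup>2 * (x powr (q - 1))\<^sup>2"
    by (simp only: power_mult_distrib)
  also have "(x powr (q - 1))\<^sup>2 = x powr (q - 2) * x powr q"
    by (simp add: power2_eq_square flip: powr_add)
  also have "q\<^sup>2 * \<bar>a - b\<bar>\<^sup>2 * (x powr (q - 2) * x powr q) \<le> q\<^sup>2 * \<delta>\<^sup>2 * (R powr (q - 2) * (\<bar>a\<bar> powr q + \<bar>b\<bar> powr q))"
    using x assms by (intro mult_mono powr_mono2 power_mono order.refl) auto
  finally show ?thesis
    by (simp add: mult.assoc)
qed

section \<open>Estimate of Dudley's entropy sum\<close>

text \<open>Used to weaken the decay 2^(-2^k/N) to N/2^k, which suffices for a geometric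
  tail.\<close>

lemma le_two_powr:
  fixes y :: real
  assumes "y \<ge> 0"
  shows "y \<le> 2 powr y"
proof -
  have "2/3 * y \<le> y * ln 2"
    using mult_right_mono[OF ln2_ge_two_thirds assms] by (simp add: mult.commute)
  then have "exp (2/3 * y) \<le> 2 powr y"
    by (simp add: powr_def)
  moreover have "1 + 2/3 * y + (2/3 * y)\<^sup>2 / 2 \<le> exp (2/3 * y)"
    using assms by (intro exp_lower_Taylor_quadratic) auto
  \<comment> \<open>The difference 1 - y/3 + 2y^2/9 of the two sides below is smallest at y =
    3/4.\<close>
  moreover have "0 \<le> (y - 3/4)\<^sup>2"
    by simp
  then have "y \<le> 1 + 2/3 * y + (2/3 * y)\<^sup>2 / 2"
    by (simp add: power2_eq_square field_simps)
  ultimately show ?thesis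
    by linarith
qed

text \<open>Up to log N the terms are geometric with ratio 2^(1/2 - 1/q); beyond it they are
  dominated by a geometric series of ratio 1/sqrt 2 that starts near sqrt N. The constant 6 is 3/2
  for the \<open>Y\<close> term plus 1 + 7/2 for the \<open>sqrt N\<close> terms.\<close>

lemma entropy_sum_le:
  fixes q :: real and N K :: nat
  assumes "q > 2" "N \<ge> 1"
  defines "b \<equiv> \<lambda>k. if real k \<le> log 2 N then (N / 2 ^ k) powr (1 / q) else 2 powr (- (2 ^ k / N))"
  defines "Y \<equiv> (real N powr (1/2) - real N powr (1 / q)) / (1/2 - 1 / q)"
  shows "(\<Sum>k\<le>K. sqrt (2 ^ k) * b k) \<le> 6 * sqrt (max (Y\<^sup>2) (real N))"
proof -
  define n where "n = nat \<lfloor>log 2 N\<rfloor>"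
  define s where "s = 1/2 - 1 / q"
  define x where "x = (2::real) powr s"
  have N: "real N \<ge> 1" "real N > 0"
    using \<open>N \<ge> 1\<close> by auto
  have log: "log 2 N \<ge> 0"
    using N by simp
  have n: "real k \<le> log 2 N \<longleftrightarrow> k \<le> n" for k
    using log by (simp add: n_def le_nat_iff le_floor_iff)
  have s: "s > 0"
    using \<open>q > 2\<close> by (simp add: s_def field_simps)
  \<comment> \<open>The ratio tends to 1 as q tends to 2. This linear lower bound yields the
    denominator 1/2 - 1/q of \<open>Y\<close> with a constant independent of q.\<close>
  have x: "x - 1 \<ge> 2/3 * s"
  proof -
    have "1 + s * ln 2 \<le> x"
      unfolding x_def powr_def using exp_ge_add_one_self[of "s * ln 2"] by simp
    moreover have "s * (2/3) \<le> s * ln 2"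
      using s ln2_ge_two_thirds by (intro mult_left_mono) auto
    ultimately show ?thesis
      by simp
  qed
  then have x1: "x > 1"
    using s by linarith
  have xn: "x ^ n \<le> N powr s"
  proof -
    have "x ^ n = 2 powr (real n * s)"
      by (simp add: x_def powr_powr mult.commute flip: powr_realpow)
    also have "\<dots> \<le> 2 powr (log 2 N * s)"
      using n[of n] s by (intro powr_mono mult_right_mono) auto
    also have "\<dots> = N powr s"
      using N by (simp flip: powr_powr)
    finally show ?thesis .
  qed
  have low: "(\<Sum>k\<le>n. sqrt (2 ^ k) * b k) \<le> 3/2 * Y + sqrt N"
  proof -
    have "sqrt (2 ^ k) * b k = N powr (1 / q) * x ^ k" if "k \<le> n" for k
    proof -
      have "sqrt (2 ^ k) = 2 powr (real k / 2)"
        by (simp add: powr_half_sqrt[symmetric] powr_powr flip: powr_realpow)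
      moreover have "b k = N powr (1 / q) / 2 powr (real k / q)"
        using n that by (simp add: b_def powr_divide powr_powr flip: powr_realpow)
      moreover have "x ^ k = 2 powr (real k / 2) / 2 powr (real k / q)"
        by (simp add: x_def s_def powr_powr algebra_simps flip: powr_realpow powr_diff)
      ultimately show ?thesis
        by simp
    qed
    then have "(\<Sum>k\<le>n. sqrt (2 ^ k) * b k) = N powr (1 / q) * (\<Sum>k\<le>n. x ^ k)"
      by (simp add: sum_distrib_left)
    \<comment> \<open>Splitting off the last term leaves \<open>x ^ n - 1\<close> in the numerator,
      the source of the difference N^(1/2) - N^(1/q).\<close>
    also have "(\<Sum>k\<le>n. x ^ k) = (x ^ n - 1) / (x - 1) + x ^ n"
      using x1 geometric_sum[of x n] by (simp flip: lessThan_Suc_atMost)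
    also have "\<dots> \<le> (N powr s - 1) / (2/3 * s) + N powr s"
      using xn x s x1 N by (intro add_mono frac_le) (auto intro: ge_one_powr_ge_zero)
    also have "N powr (1 / q) * ((N powr s - 1) / (2/3 * s) + N powr s) =
        3/2 * ((N powr (1 / q) * N powr s - N powr (1 / q)) / s) + N powr (1 / q) * N powr s"
      using s by (simp add: field_simps)
    also have "N powr (1 / q) * N powr s = N powr (1/2)"
      by (simp add: s_def flip: powr_add)
    finally show ?thesis
      using N by (simp add: Y_def s_def powr_half_sqrt mult_left_mono)
  qed
  define y where "y = 1 / sqrt 2"
  have y: "0 < y" "y < 1" "1 / (1 - y) \<le> 7/2"
  proof -
    show "0 < y" "y < 1"
      by (auto simp: y_def)
    have "7/5 \<le> sqrt 2"
      by (rule real_le_rsqrt) (simp add: power2_eq_square)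
    then have "y \<le> 5/7"
      by (simp add: y_def field_simps)
    then show "1 / (1 - y) \<le> 7/2"
      by (simp add: field_simps)
  qed
  have high: "(\<Sum>k\<in>{Suc n..K}. sqrt (2 ^ k) * b k) \<le> 7/2 * sqrt N"
  proof -
    have yk: "y ^ k = 1 / sqrt (2 ^ k)" for k
      by (simp add: y_def power_divide real_sqrt_power)
    have "sqrt (2 ^ k) * b k \<le> N * y ^ k" if "k \<in> {Suc n..K}" for k
    proof -
      have "2 ^ k / N \<le> 2 powr (2 ^ k / N)"
        by (rule le_two_powr) simp
      then have "2 powr (- (2 ^ k / N)) \<le> N / 2 ^ k"
        using N by (simp add: powr_minus field_simps)
      moreover have "b k = 2 powr (- (2 ^ k / N))"
        using n[of k] that by (simp add: b_def)
      ultimately have "sqrt (2 ^ k) * b k \<le> sqrt (2 ^ k) * (N / 2 ^ k)"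
        by (intro mult_left_mono) auto
      also have "\<dots> = N * (sqrt (2 ^ k) / 2 ^ k)"
        by simp
      also have "sqrt (2 ^ k) / 2 ^ k = 1 / sqrt (2 ^ k)"
        by (simp add: field_simps)
      finally show ?thesis
        by (simp add: yk)
    qed
    then have "(\<Sum>k\<in>{Suc n..K}. sqrt (2 ^ k) * b k) \<le> N * (\<Sum>k\<in>{Suc n..K}. y ^ k)"
      unfolding sum_distrib_left by (rule sum_mono)
    also have "\<dots> \<le> N * (y ^ Suc n / (1 - y))"
    proof (intro mult_left_mono)
      show "(\<Sum>k\<in>{Suc n..K}. y ^ k) \<le> y ^ Suc n / (1 - y)"
        using y by (auto simp: sum_gp divide_right_mono intro!: divide_nonneg_pos)
    qed simp
    also have "\<dots> = (N * y ^ Suc n) * (1 / (1 - y))"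
      by simp
    also have "\<dots> \<le> sqrt N * (7/2)"
    proof (intro mult_mono y)
      \<comment> \<open>As \<open>n\<close> is the floor of log N, the first tail index satisfies
        2^(n+1) > N, so the factor N is reduced to sqrt N.\<close>
      have "log 2 N < real (Suc n)"
        using n[of "Suc n"] by simp
      then have "real N < 2 powr (real (Suc n))"
        using N by (simp add: log_less_iff)
      then have "sqrt N \<le> sqrt (2 ^ Suc n)"
        by (subst (asm) powr_realpow) auto
      then have "y ^ Suc n \<le> 1 / sqrt N"
        unfolding yk using N by (intro divide_left_mono) auto
      then have "N * y ^ Suc n \<le> N * (1 / sqrt N)"
        by (intro mult_left_mono) auto
      also have "\<dots> = sqrt N"
        by (simp add: real_div_sqrt)
      finally show "N * y ^ Suc n \<le> sqrt N" .
    qed (use y in auto)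
    finally show ?thesis
      by simp
  qed
  have b: "b k \<ge> 0" for k
    by (simp add: b_def)
  \<comment> \<open>Only an inequality, because \<open>n\<close> may exceed
    \<open>K\<close>.\<close>
  have "(\<Sum>k\<le>K. sqrt (2 ^ k) * b k) \<le> (\<Sum>k\<in>{..n} \<union> {Suc n..K}. sqrt (2 ^ k) * b k)"
    using b by (intro sum_mono2) auto
  also have "\<dots> = (\<Sum>k\<le>n. sqrt (2 ^ k) * b k) + (\<Sum>k\<in>{Suc n..K}. sqrt (2 ^ k) * b k)"
    by (intro sum.union_disjoint) auto
  also have "\<dots> \<le> 3/2 * Y + 9/2 * sqrt N"
    using low high by linarith
  also have "\<dots> \<le> 6 * sqrt (max (Y\<^sup>2) (real N))"
  proof -
    have "Y \<le> sqrt (max (Y\<^sup>2) (real N))" "sqrt N \<le> sqrt (max (Y\<^sup>2) (real N))"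
      by (auto intro: real_le_rsqrt)
    then show ?thesis
      by linarith
  qed
  finally show ?thesis .
qed

section \<open>Nets in the uniform metric\<close>

text \<open>The infimum defining the entropy number need not be attained, hence the radius strictly
  above the bound.\<close>

lemma entropy_num_net:
  assumes "entropy_num \<Omega> A k \<le> ereal b" "b < \<eta>"
  shows "\<exists>F. finite F \<and> F \<noteq> {} \<and> F \<subseteq> A \<and> card F \<le> Nn k \<and> (\<forall>f\<in>A. \<exists>g\<in>F. sup_dist \<Omega> g f < \<eta>)"
proof -
  have "entropy_num \<Omega> A k < ereal \<eta>"
    using assms by (meson ereal_less(3) le_less_trans less_ereal.simps(1))
  then obtain \<epsilon> F where "\<epsilon> < \<eta>" "finite F" "F \<noteq> {}" "F \<subseteq> A" "card F \<le> Nn k"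
    and cover: "A \<subseteq> (\<Union>f\<in>F. {g. sup_dist \<Omega> f g < \<epsilon>})"
    unfolding entropy_num_def Inf_less_iff by auto
  moreover have "\<forall>f\<in>A. \<exists>g\<in>F. sup_dist \<Omega> g f < \<eta>"
  proof
    fix f assume "f \<in> A"
    with cover obtain g where "g \<in> F" "sup_dist \<Omega> g f < \<epsilon>"
      by auto
    with \<open>\<epsilon> < \<eta>\<close> show "\<exists>g\<in>F. sup_dist \<Omega> g f < \<eta>"
      by (intro bexI[of _ g]) auto
  qed
  ultimately show ?thesis
    by blast
qed

text \<open>Compactness and continuity supply the upper bound without which a real
  \<open>SUP\<close> would be an unspecified value.\<close>

lemma abs_diff_le_sup_dist:
  fixes f g :: "'a::topological_space \<Rightarrow> real"
  assumes "compact \<Omega>" "continuous_on \<Omega> f" "continuous_on \<Omega> g" "x \<in> \<Omega>"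
  shows "\<bar>f x - g x\<bar> \<le> sup_dist \<Omega> f g"
proof -
  have "compact ((\<lambda>x. \<bar>f x - g x\<bar>) ` \<Omega>)"
    using assms by (intro compact_continuous_image continuous_intros)
  then have "bdd_above ((\<lambda>x. \<bar>f x - g x\<bar>) ` \<Omega>)"
    by (intro bounded_imp_bdd_above compact_imp_bounded)
  then show ?thesis
    unfolding sup_dist_def using \<open>x \<in> \<Omega>\<close> by (rule cSUP_upper[rotated])
qed

subsection \<open>Discretization of the norm\<close>

text \<open>The chaining bound for a fixed sample contains the empirical sums, which are themselves
  at most m(9/8 + D/m) for the net error D. Taking expectations gives a linear inequality for the
  mean of D, and some sample does no worse than its mean. The singleton \<open>F 0\<close> starts
  the chain at zero, and \<open>fine\<close> transfers the result from the net \<open>F K\<close> to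
  \<open>A\<close>.\<close>

lemma discretization_of_nets:
  fixes M :: "'a measure" and A :: "('a \<Rightarrow> real) set" and F :: "nat \<Rightarrow> ('a \<Rightarrow> real) set"
  assumes "prob_space M" and "q \<ge> 2" "R > 0" "m > 0"
    and meas: "\<And>f. f \<in> A \<Longrightarrow> f \<in> borel_measurable M"
    and bd: "\<And>f x. f \<in> A \<Longrightarrow> x \<in> space M \<Longrightarrow> \<bar>f x\<bar> \<le> R"
    and ball: "\<And>f. f \<in> A \<Longrightarrow> Lq_pow M q f \<le> 1"
    and F0: "F 0 = {\<lambda>_. 0}"
    and F: "\<And>k. k \<le> K \<Longrightarrow> finite (F k) \<and> F k \<noteq> {} \<and> F k \<subseteq> A \<and> card (F k) \<le> Nn k"
    and \<eta>: "\<And>k. \<eta> k > 0"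
    and net: "\<And>k f. k \<le> K \<Longrightarrow> f \<in> A \<Longrightarrow> \<exists>g\<in>F k. \<forall>x\<in>space M. \<bar>f x - g x\<bar> \<le> \<eta> k"
    and fine: "q * \<eta> K * R powr (q - 1) \<le> 1/8"
    and m: "40 * (\<Sum>k<K. sqrt (2 ^ Suc k) * (sqrt 2 * q * (\<eta> (Suc k) + \<eta> k) * sqrt (R powr (q - 2)))) \<le> sqrt m"
  shows "\<exists>\<xi>. (\<forall>j<m. \<xi> j \<in> space M) \<and>
    (\<forall>f\<in>A. \<bar>(1 / real m) * (\<Sum>j<m. \<bar>f (\<xi> j)\<bar> powr q) - Lq_pow M q f\<bar> \<le> 1/2)"
proof -
  interpret M: prob_space M by fact
  define P where "P = PiM {..<m} (\<lambda>_. M)"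
  interpret P: prob_space P unfolding P_def by (intro prob_space_PiM M.prob_space_axioms)
  define T where "T = F K"
  have T: "finite T" "T \<noteq> {}" "T \<subseteq> A"
    using F[of K] by (auto simp: T_def)
  obtain p where p: "\<And>k f. k \<le> K \<Longrightarrow> f \<in> A \<Longrightarrow> p k f \<in> F k \<and> (\<forall>x\<in>space M. \<bar>f x - p k f x\<bar> \<le> \<eta> k)"
    using net by metis
  define h where "h f x = \<bar>f x\<bar> powr q" for f :: "'a \<Rightarrow> real" and x
  have Lq: "Lq_pow M q f = (\<integral>x. h f x \<partial>M)" for f
    by (simp add: Lq_pow_def h_def)
  have h_meas: "h f \<in> borel_measurable M" if "f \<in> A" for f
    unfolding h_def using meas[OF that] by measurable
  have h_bd: "0 \<le> h f x" "\<bar>h f x\<bar> \<le> R powr q" if "f \<in> A" "x \<in> space M" for f x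
    using bd[OF that] \<open>q \<ge> 2\<close> by (auto simp: h_def intro: powr_mono2)
  have h_int: "integrable M (h f)" if "f \<in> A" for f
    using h_meas[OF that] h_bd[OF that] by (intro M.integrable_const_bound[of _ "R powr q"]) auto
  have h_close: "\<bar>h f x - h (p K f) x\<bar> \<le> 1/8" if "f \<in> A" "x \<in> space M" for f x
  proof -
    have pA: "p K f \<in> A"
      using p[of K f] F[of K] that by auto
    have "\<bar>h f x - h (p K f) x\<bar> \<le> q * \<eta> K * R powr (q - 1)"
      unfolding h_def using p[of K f] bd[OF that] bd[OF pA that(2)] that \<open>q \<ge> 2\<close>
      by (intro abs_powr_diff_le_bounded) auto
    then show ?thesis
      using fine by linarith
  qed
  define D where "D \<xi> = (MAX f\<in>T. \<bar>(\<Sum>j<m. h f (\<xi> j)) - real m * (\<integral>x. h f x \<partial>M)\<bar>)" for \<xi> :: "nat \<Rightarrow> 'a"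
  have in_space: "\<xi> j \<in> space M" if "\<xi> \<in> space P" "j < m" for \<xi> j
    using that by (auto simp: P_def space_PiM)
  have sum_close: "\<bar>(\<Sum>j<m. h f (\<xi> j)) - (\<Sum>j<m. h (p K f) (\<xi> j))\<bar> \<le> real m * (1/8)"
    if "f \<in> A" "\<xi> \<in> space P" for f \<xi>
  proof -
    have "\<bar>\<Sum>j<m. h f (\<xi> j) - h (p K f) (\<xi> j)\<bar> \<le> (\<Sum>j<m. \<bar>h f (\<xi> j) - h (p K f) (\<xi> j)\<bar>)"
      by (rule sum_abs)
    also have "\<dots> \<le> real (card {..<m}) * (1/8)"
      using h_close[OF that(1)] in_space[OF that(2)] by (intro sum_bounded_above) auto
    finally show ?thesis
      by (simp add: sum_subtractf)
  qed
  have D_ge: "\<bar>(\<Sum>j<m. h f (\<xi> j)) - real m * (\<integral>x. h f x \<partial>M)\<bar> \<le> D \<xi>" if "f \<in> T" for f \<xi>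
    unfolding D_def using that T by (intro Max_ge) auto
  have pT: "p K f \<in> T" "p K f \<in> A" if "f \<in> A" for f
    using p[of K f] that T by (auto simp: T_def)
  have D_nonneg: "0 \<le> D \<xi>" for \<xi>
  proof -
    obtain f where "f \<in> T"
      using T by auto
    from D_ge[OF this, of \<xi>] show ?thesis
      by linarith
  qed
  \<comment> \<open>1 bounds the norm on the ball and 1/8 is the cost of replacing f by its
    neighbour in the finest net.\<close>
  define S where "S \<xi> = 9/8 + D \<xi> / m" for \<xi>
  have S_nonneg: "S \<xi> \<ge> 0" for \<xi>
    using D_nonneg by (simp add: S_def)
  have S: "(\<Sum>j<m. h f (\<xi> j)) \<le> real m * S \<xi>" if "f \<in> A" "\<xi> \<in> space P" for f \<xi>
  proof -
    have "real m * (\<integral>x. h (p K f) x \<partial>M) \<le> real m * 1"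
      using ball[OF pT(2)[OF that(1)]] by (intro mult_left_mono) (auto simp: Lq)
    then have "(\<Sum>j<m. h f (\<xi> j)) \<le> real m * (1/8) + real m + D \<xi>"
      using sum_close[OF that] D_ge[OF pT(1)[OF that(1)], of \<xi>] by linarith
    also have "\<dots> = real m * S \<xi>"
      using \<open>m > 0\<close> by (simp add: S_def field_simps)
    finally show ?thesis .
  qed

  \<comment> \<open>The factor \<open>sqrt 2\<close> accounts for the two empirical sums, one for
    each end of a link.\<close>
  define c where "c k = sqrt 2 * q * (\<eta> (Suc k) + \<eta> k) * sqrt (R powr (q - 2))" for k
  define \<Gamma> where "\<Gamma> = (\<Sum>k<K. sqrt (2 ^ Suc k) * c k)"
  have c_pos: "c k > 0" for k
    using \<eta>[of k] \<eta>[of "Suc k"] \<open>q \<ge> 2\<close> \<open>R > 0\<close> by (simp add: c_def)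
  have \<Gamma>: "\<Gamma> \<ge> 0" "40 * \<Gamma> \<le> sqrt m"
    using c_pos m by (auto simp: \<Gamma>_def c_def[symmetric] intro!: sum_nonneg mult_nonneg_nonneg less_imp_le[OF c_pos])
  \<comment> \<open>The neighbour \<open>p K f\<close> chosen for a point f of the finest net may
    differ from f, whereas the chain has to end at f itself.\<close>
  define r where "r k f = (if k = K then f else p k f)" for k f
  have r_in: "r k f \<in> F k" "r k f \<in> A" "\<And>x. x \<in> space M \<Longrightarrow> \<bar>f x - r k f x\<bar> \<le> \<eta> k"
    if "k \<le> K" "f \<in> T" for k f
    using p[of k f] F[of k] that T less_imp_le[OF \<eta>[of k]] by (auto simp: r_def T_def)
  have chain: "sign_avg m (\<lambda>\<epsilon>. MAX f\<in>T. \<bar>\<Sum>j<m. \<epsilon> j * h f (\<xi> j)\<bar>) \<le> sqrt m * \<Gamma> * (2 + S \<xi>)"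
    if \<xi>: "\<xi> \<in> space P" for \<xi>
    unfolding \<Gamma>_def
  proof (rule sign_avg_chaining[where p = r])
    show "h (r 0 f) (\<xi> j) = 0" if "f \<in> T" for f j
      using r_in(1)[of 0 f] that F0 by (simp add: h_def)
    show "card (r k ` T) \<le> Nn k" if "k \<le> K" for k
    proof -
      have "card (r k ` T) \<le> card (F k)"
        using r_in(1)[OF that] F[OF that] by (intro card_mono) auto
      then show ?thesis
        using F[OF that] by linarith
    qed
    fix k f assume k: "k < K" and f: "f \<in> T"
    let ?g = "r (Suc k) f" and ?g' = "r k f"
    let ?C = "q\<^sup>2 * (\<eta> (Suc k) + \<eta> k)\<^sup>2 * R powr (q - 2)"
    have g: "?g \<in> A" "?g' \<in> A"
      using r_in k f by auto
    have "(\<Sum>j<m. (h ?g (\<xi> j) - h ?g' (\<xi> j))\<^sup>2) \<le> (\<Sum>j<m. ?C * (h ?g (\<xi> j) + h ?g' (\<xi> j)))"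
    proof (rule sum_mono)
      fix j assume "j \<in> {..<m}"
      then have x: "\<xi> j \<in> space M"
        using in_space[OF \<xi>] by simp
      have "\<bar>?g (\<xi> j) - ?g' (\<xi> j)\<bar> \<le> \<eta> (Suc k) + \<eta> k"
        using r_in(3)[of "Suc k" f, OF _ f x] r_in(3)[of k f, OF _ f x] k by linarith
      then show "(h ?g (\<xi> j) - h ?g' (\<xi> j))\<^sup>2 \<le> ?C * (h ?g (\<xi> j) + h ?g' (\<xi> j))"
        unfolding h_def using \<open>q \<ge> 2\<close> bd[OF g(1) x] bd[OF g(2) x] by (intro abs_powr_diff_sq_le) auto
    qed
    also have "\<dots> = ?C * ((\<Sum>j<m. h ?g (\<xi> j)) + (\<Sum>j<m. h ?g' (\<xi> j)))"
      by (simp only: sum.distrib flip: sum_distrib_left)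
    also have "\<dots> \<le> ?C * (real m * S \<xi> + real m * S \<xi>)"
      by (intro mult_left_mono add_mono S g \<xi>) auto
    also have "\<dots> = (2 * ?C) * real m * S \<xi>"
      by simp
    also have "2 * ?C = (c k)\<^sup>2"
      by (simp add: c_def power_mult_distrib)
    finally show "(\<Sum>j<m. (h ?g (\<xi> j) - h ?g' (\<xi> j))\<^sup>2) \<le> (c k)\<^sup>2 * real m * S \<xi>" .
  qed (use T \<open>m > 0\<close> S_nonneg c_pos in \<open>auto simp: r_def\<close>)

  have D_int: "integrable P D"
    unfolding D_def
  proof (rule integrable_Max_abs[OF P.prob_space_axioms T(1,2)])
    fix f assume f: "f \<in> T"
    have comp: "(\<lambda>\<xi>. h f (\<xi> j)) \<in> borel_measurable P" if "j \<in> {..<m}" for j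
      unfolding P_def using measurable_compose[OF measurable_component_singleton[OF that] h_meas] f T by blast
    then show "(\<lambda>\<xi>. (\<Sum>j<m. h f (\<xi> j)) - real m * (\<integral>x. h f x \<partial>M)) \<in> borel_measurable P"
      by (intro borel_measurable_diff borel_measurable_const borel_measurable_sum)
    fix \<xi> assume \<xi>: "\<xi> \<in> space P"
    have fA: "f \<in> A"
      using f T by auto
    have "(\<Sum>j<m. h f (\<xi> j)) \<le> real (card {..<m}) * R powr q"
      using h_bd[OF fA] in_space[OF \<xi>] by (intro sum_bounded_above) force
    moreover have "0 \<le> (\<Sum>j<m. h f (\<xi> j))"
      by (simp add: h_def sum_nonneg)
    moreover have "0 \<le> (\<integral>x. h f x \<partial>M)" "(\<integral>x. h f x \<partial>M) \<le> 1"
      using ball[OF fA] by (auto simp: Lq h_def)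
    then have "0 \<le> real m * (\<integral>x. h f x \<partial>M)" "real m * (\<integral>x. h f x \<partial>M) \<le> real m * 1"
      using mult_left_mono[of "\<integral>x. h f x \<partial>M" 1 "real m"] by simp_all
    ultimately show "\<bar>(\<Sum>j<m. h f (\<xi> j)) - real m * (\<integral>x. h f x \<partial>M)\<bar> \<le> real m * R powr q + real m"
      by simp
  qed
  define e where "e = (\<integral>\<xi>. D \<xi> \<partial>P) / m"
  have e: "e \<ge> 0"
    using D_nonneg by (simp add: e_def)
  have "(\<integral>\<xi>. D \<xi> \<partial>P) \<le> 2 * (\<integral>\<xi>. sign_avg m (\<lambda>\<epsilon>. MAX f\<in>T. \<bar>\<Sum>j<m. \<epsilon> j * h f (\<xi> j)\<bar>) \<partial>P)"
    unfolding D_def P_def using T h_meas h_bd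
    by (intro symmetrization[where H = "R powr q"] \<open>prob_space M\<close>) auto
  \<comment> \<open>\<open>integral_mono'\<close> asks only for an integrable, nonnegative upper
    bound: a Bochner integral that does not exist is 0.\<close>
  also have "\<dots> \<le> 2 * (\<integral>\<xi>. sqrt m * \<Gamma> * (2 + S \<xi>) \<partial>P)"
    using chain D_int S_nonneg \<Gamma>(1) by (intro mult_left_mono integral_mono') 
      (auto simp: S_def add_nonneg_nonneg D_nonneg)
  also have "(\<integral>\<xi>. sqrt m * \<Gamma> * (2 + S \<xi>) \<partial>P) = sqrt m * \<Gamma> * (25/8 + e)"
    using D_int by (simp add: S_def e_def P.prob_space)
  also have "2 * (sqrt m * \<Gamma> * (25/8 + e)) \<le> 2 * (sqrt m * (sqrt m / 40) * (25/8 + e))"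
    using \<Gamma> e by (intro mult_left_mono mult_right_mono) auto
  also have "\<dots> = m * ((25/8 + e) / 20)"
    by simp
  \<comment> \<open>Here 25/8 = 2 + 9/8 and 20 = 40/2. Solving for \<open>e\<close> gives 25/152,
    which is below 1/4.\<close>
  finally have "e \<le> (25/8 + e) / 20"
    using \<open>m > 0\<close> by (simp add: e_def field_simps)
  then have e_le: "(\<integral>\<xi>. D \<xi> \<partial>P) \<le> m / 4"
    using \<open>m > 0\<close> by (simp add: e_def field_simps)
  have "\<exists>\<xi>\<in>space P. D \<xi> \<le> m / 4"
  proof (rule ccontr)
    assume "\<not> ?thesis"
    then have "AE \<xi> in P. m / 4 < D \<xi>"
      by (intro AE_I2) auto
    from P.expectation_greater[OF D_int this] e_le show False
      by linarith
  qed
  then obtain \<xi> where \<xi>: "\<xi> \<in> space P" "D \<xi> \<le> m / 4"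
    by blast
  have "\<bar>(1 / real m) * (\<Sum>j<m. \<bar>f (\<xi> j)\<bar> powr q) - Lq_pow M q f\<bar> \<le> 1/2" if f: "f \<in> A" for f
  proof -
    have "\<bar>(\<integral>x. h f x \<partial>M) - (\<integral>x. h (p K f) x \<partial>M)\<bar> = \<bar>\<integral>x. h f x - h (p K f) x \<partial>M\<bar>"
      using h_int f pT by simp
    also have "\<dots> \<le> (\<integral>x. \<bar>h f x - h (p K f) x\<bar> \<partial>M)"
      by (rule integral_abs_bound)
    also have "\<dots> \<le> 1/8"
      using h_int f pT h_close[OF f] by (intro M.integral_le_const) auto
    finally have "real m * \<bar>(\<integral>x. h f x \<partial>M) - (\<integral>x. h (p K f) x \<partial>M)\<bar> \<le> real m * (1/8)"
      by (intro mult_left_mono) auto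
    then have "\<bar>real m * (\<integral>x. h f x \<partial>M) - real m * (\<integral>x. h (p K f) x \<partial>M)\<bar> \<le> real m * (1/8)"
      by (simp add: abs_mult flip: right_diff_distrib)
    \<comment> \<open>The error 1/2 splits into 1/8 for the empirical sum, 1/8 for the integral and
      1/4 on the net.\<close>
    with sum_close[OF f \<xi>(1)] D_ge[OF pT(1)[OF f], of \<xi>] \<xi>(2)
    have "\<bar>(\<Sum>j<m. h f (\<xi> j)) - real m * (\<integral>x. h f x \<partial>M)\<bar> \<le> real m * (1/2)"
      by linarith
    moreover have "(1 / real m) * (\<Sum>j<m. h f (\<xi> j)) - (\<integral>x. h f x \<partial>M)
        = ((\<Sum>j<m. h f (\<xi> j)) - real m * (\<integral>x. h f x \<partial>M)) / real m"
      using \<open>m > 0\<close> by (simp add: field_simps)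
    ultimately show ?thesis
      unfolding Lq h_def[symmetric] using \<open>m > 0\<close>
      by (simp only: abs_divide abs_of_nat) (simp add: divide_le_eq)
  qed
  with in_space[OF \<xi>(1)] show ?thesis
    by blast
qed

section \<open>Homogeneity, the uniform bound and the choice of scales\<close>

lemma Lq_pow_nonneg: "0 \<le> Lq_pow \<mu> q f"
  by (simp add: Lq_pow_def)

lemma Lq_pow_scale: "Lq_pow \<mu> q (\<lambda>x. t * f x) = \<bar>t\<bar> powr q * Lq_pow \<mu> q f"
  by (simp add: Lq_pow_def abs_mult powr_mult)

lemma Lq_norm_le_1_iff:
  assumes "q > 0"
  shows "Lq_norm \<mu> q f \<le> 1 \<longleftrightarrow> Lq_pow \<mu> q f \<le> 1"
proof
  assume "Lq_norm \<mu> q f \<le> 1"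
  then have "(Lq_pow \<mu> q f powr (1 / q)) powr q \<le> 1 powr q"
    using assms by (intro powr_mono2) (auto simp: Lq_norm_def)
  then show "Lq_pow \<mu> q f \<le> 1"
    using assms Lq_pow_nonneg[of \<mu> q f] by (simp add: powr_powr)
next
  assume "Lq_pow \<mu> q f \<le> 1"
  then have "Lq_pow \<mu> q f powr (1 / q) \<le> 1 powr (1 / q)"
    using assms Lq_pow_nonneg[of \<mu> q f] by (intro powr_mono2) auto
  then show "Lq_norm \<mu> q f \<le> 1"
    by (simp add: Lq_norm_def)
qed

lemma span_fun_scale: "f \<in> span_fun N \<phi> \<Longrightarrow> (\<lambda>x. t * f x) \<in> span_fun N \<phi>"
proof -
  assume "f \<in> span_fun N \<phi>"
  then obtain a where "f = (\<lambda>x. \<Sum>i<N. a i * \<phi> i x)"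
    by (auto simp: span_fun_def)
  then have "(\<lambda>x. t * f x) = (\<lambda>x. \<Sum>i<N. (t * a i) * \<phi> i x)"
    by (simp add: sum_distrib_left mult.assoc)
  then show ?thesis
    by (auto simp: span_fun_def)
qed

lemma zero_in_span_fun: "(\<lambda>_. 0) \<in> span_fun N \<phi>"
  unfolding span_fun_def by (rule CollectI, rule exI[of _ "\<lambda>_. 0"]) simp

lemma continuous_on_span_fun:
  assumes "\<And>i. i < N \<Longrightarrow> continuous_on \<Omega> (\<phi> i)" "f \<in> span_fun N \<phi>"
  shows "continuous_on \<Omega> f"
  using assms by (auto simp: span_fun_def intro!: continuous_intros)

text \<open>A single ball of radius \<open>b\<close> covering the symmetric set \<open>A\<close> contains \<open>f\<close> and \<open>-f\<close>, so the
  centre cancels and there is no loss of a factor 2, which would be raised to the power \<open>q\<close>.\<close>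

lemma entropy_num_0_bound:
  fixes f :: "'a::topological_space \<Rightarrow> real"
  assumes "compact \<Omega>" and cont: "\<And>f. f \<in> A \<Longrightarrow> continuous_on \<Omega> f"
    and sym: "\<And>f. f \<in> A \<Longrightarrow> (\<lambda>x. - f x) \<in> A"
    and ent: "entropy_num \<Omega> A 0 \<le> ereal b" and f: "f \<in> A" and x: "x \<in> \<Omega>"
  shows "\<bar>f x\<bar> \<le> b"
proof (rule field_le_epsilon)
  fix e :: real assume "e > 0"
  then obtain F where F: "finite F" "F \<noteq> {}" "F \<subseteq> A" "card F \<le> Nn 0"
    and net: "\<forall>f\<in>A. \<exists>g\<in>F. sup_dist \<Omega> g f < b + e"
    using entropy_num_net[OF ent, of "b + e"] by auto
  have "card F = 1"
    using F by (simp add: Nn_def card_gt_0_iff le_Suc_eq)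
  then obtain g where g: "F = {g}"
    by (auto simp: card_1_singleton_iff)
  have gA: "g \<in> A"
    using F g by auto
  have "\<bar>g x - f x\<bar> < b + e"
    using net f g abs_diff_le_sup_dist[OF \<open>compact \<Omega>\<close> cont[OF gA] cont[OF f] x] by auto
  moreover have "\<bar>g x - - f x\<bar> < b + e"
    using net sym[OF f] g abs_diff_le_sup_dist[OF \<open>compact \<Omega>\<close> cont[OF gA] cont[OF sym[OF f]] x] by auto
  ultimately show "\<bar>f x\<bar> \<le> b + e"
    by linarith
qed

text \<open>Supplies the finest scale, at which chaining stops. Taking 2^K > N puts it in the range
  of exponential decay.\<close>

lemma exists_small_entropy_bound:
  fixes q e :: real and N :: nat
  assumes "N \<ge> 1" "e > 0"
  shows "\<exists>K::nat. (if real K \<le> log 2 (real N) then (real N / 2 ^ K) powr (1 / q)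
    else 2 powr (- (2 ^ K / real N))) \<le> e"
proof -
  obtain K :: nat where K: "max (real N) (N / e) < 2 ^ K"
    using real_arch_pow[of 2 "max (real N) (N / e)"] by auto
  have "log 2 N < K"
    using K \<open>N \<ge> 1\<close> by (simp add: log_less_iff powr_realpow)
  moreover have "2 ^ K / N \<le> 2 powr (2 ^ K / N)"
    by (rule le_two_powr) simp
  then have "2 powr (- (2 ^ K / N)) \<le> N / 2 ^ K"
    using \<open>N \<ge> 1\<close> by (simp add: powr_minus field_simps)
  moreover have "N / 2 ^ K \<le> e"
    using K \<open>e > 0\<close> by (simp add: field_simps)
  ultimately show ?thesis
    by (intro exI[of _ K]) auto
qed

text \<open>A link costs the radii of both its ends. The radii at \<open>Suc k\<close> already carry
  the matching weight and contribute 1; those at \<open>k\<close> have a weight too large by sqrt 2,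
  at most 3/2.\<close>

lemma shifted_sum_le:
  fixes b :: "nat \<Rightarrow> real"
  assumes b: "\<And>k. b k \<ge> 0"
  shows "(\<Sum>k<K. sqrt (2 ^ Suc k) * (b (Suc k) + b k)) \<le> 5/2 * (\<Sum>k\<le>K. sqrt (2 ^ k) * b k)"
proof -
  let ?s = "\<lambda>k. sqrt (2 ^ k) * b k"
  have pos: "?s k \<ge> 0" for k
    using b by simp
  have "(\<Sum>k<K. sqrt (2 ^ Suc k) * (b (Suc k) + b k)) = (\<Sum>k<K. ?s (Suc k)) + sqrt 2 * (\<Sum>k<K. ?s k)"
    by (simp add: distrib_left sum.distrib sum_distrib_left real_sqrt_mult mult.assoc)
  also have "(\<Sum>k<K. ?s (Suc k)) \<le> (\<Sum>k\<le>K. ?s k)"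
    using pos[of 0] by (subst sum.atMost_shift) simp
  also have "sqrt 2 * (\<Sum>k<K. ?s k) \<le> 3/2 * (\<Sum>k\<le>K. ?s k)"
  proof (rule mult_mono)
    show "sqrt 2 \<le> 3/2"
      by (rule real_le_lsqrt) (auto simp: power2_eq_square)
    show "(\<Sum>k<K. ?s k) \<le> (\<Sum>k\<le>K. ?s k)"
      using pos by (intro sum_mono2) auto
  qed (use pos in \<open>auto intro: sum_nonneg\<close>)
  finally show ?thesis
    by simp
qed

section \<open>Application to the given subspace\<close>

theorem theorem4p4:
  shows "\<exists>c>0. \<forall>(d::nat) (\<Omega>::(nat \<Rightarrow> real) set) (\<mu>::(nat \<Rightarrow> real) measure) (q::real) (B::real)
            (N::nat) (\<phi>::nat \<Rightarrow> (nat \<Rightarrow> real) \<Rightarrow> real) (m::nat).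
     \<Omega> \<subseteq> euclid_pts d \<and> compact \<Omega> \<and>
     prob_space \<mu> \<and> space \<mu> = \<Omega> \<and> sets \<mu> = sets (restrict_space borel \<Omega>) \<and>
     2 < q \<and> B > 0 \<and> N \<ge> 1 \<and>
     (\<forall>i<N. continuous_on \<Omega> (\<phi> i)) \<and> lin_indep_on \<Omega> N \<phi> \<and>
     (\<forall>k::nat. entropy_num \<Omega> (unit_ball_q \<mu> q (span_fun N \<phi>)) k \<le>
        ereal (B * (if real k \<le> log 2 (real N)
                    then (real N / 2 ^ k) powr (1 / q)
                    else 2 powr (- (2 ^ k / real N))))) \<and>
     real m \<ge> c * q\<^sup>2 * B powr q * real N powr (1 - 2 / q) *
        max (((real N powr (1/2) - real N powr (1 / q)) / (1/2 - 1 / q))\<^sup>2) (real N)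
     \<longrightarrow> (\<exists>\<xi>::nat \<Rightarrow> (nat \<Rightarrow> real). (\<forall>j<m. \<xi> j \<in> \<Omega>) \<and>
           (\<forall>f\<in>span_fun N \<phi>.
              1/2 * Lq_pow \<mu> q f \<le> (1 / real m) * (\<Sum>j<m. \<bar>f (\<xi> j)\<bar> powr q) \<and>
              (1 / real m) * (\<Sum>j<m. \<bar>f (\<xi> j)\<bar> powr q) \<le> 3/2 * Lq_pow \<mu> q f))"
proof (rule exI[of _ 2880000], intro conjI allI impI; (elim conjE)?)
  \<comment> \<open>The constant is (80 * sqrt 2 * 15)^2: 80 is 40 times the doubling of the radii,
    sqrt 2 comes from the two ends of a link, and 15 = 5/2 * 6 from the entropy sums.\<close>
  show "(0::real) < 2880000"
    by simp
next
  fix d :: nat and \<Omega> :: "(nat \<Rightarrow> real) set" and \<mu> :: "(nat \<Rightarrow> real) measure" and q B :: real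
    and N :: nat and \<phi> :: "nat \<Rightarrow> (nat \<Rightarrow> real) \<Rightarrow> real" and m :: nat
  define X where "X = span_fun N \<phi>"
  define A where "A = unit_ball_q \<mu> q X"
  define b where "b k = (if real k \<le> log 2 (real N) then (real N / 2 ^ k) powr (1 / q)
    else 2 powr (- (2 ^ k / real N)))" for k :: nat
  define Mx where "Mx = max (((real N powr (1/2) - real N powr (1 / q)) / (1/2 - 1 / q))\<^sup>2) (real N)"
  assume comp: "compact \<Omega>" and prob: "prob_space \<mu>" and sp: "space \<mu> = \<Omega>"
    and sets: "sets \<mu> = sets (restrict_space borel \<Omega>)"
    and q: "2 < q" and B: "B > 0" and N: "N \<ge> 1"
    and \<phi>: "\<forall>i<N. continuous_on \<Omega> (\<phi> i)"
    and entropy: "\<forall>k::nat. entropy_num \<Omega> (unit_ball_q \<mu> q (span_fun N \<phi>)) k \<le>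
        ereal (B * (if real k \<le> log 2 (real N)
                    then (real N / 2 ^ k) powr (1 / q)
                    else 2 powr (- (2 ^ k / real N))))"
    and m_ge: "real m \<ge> 2880000 * q\<^sup>2 * B powr q * real N powr (1 - 2 / q) *
        max (((real N powr (1/2) - real N powr (1 / q)) / (1/2 - 1 / q))\<^sup>2) (real N)"
  have ent: "entropy_num \<Omega> A k \<le> ereal (B * b k)" for k
    using spec[OF entropy, of k] by (simp only: A_def X_def b_def)
  have cont: "continuous_on \<Omega> f" if "f \<in> X" for f
    using continuous_on_span_fun[of N \<Omega> \<phi> f] \<phi> that by (simp add: X_def)
  have m: "2880000 * q\<^sup>2 * B powr q * real N powr (1 - 2 / q) * Mx \<le> real m"
    using m_ge by (simp only: Mx_def)
  have b: "b k > 0" for k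
    using N by (simp add: b_def)
  have Mx: "Mx \<ge> 1"
    using N by (simp add: Mx_def le_max_iff_disj)
  have "real m > 0"
    using q B N Mx by (intro less_le_trans[OF _ m] mult_pos_pos) auto
  then have "m > 0"
    by simp
  have A_iff: "f \<in> A \<longleftrightarrow> f \<in> X \<and> Lq_pow \<mu> q f \<le> 1" for f
    using q by (simp add: A_def unit_ball_q_def Lq_norm_le_1_iff)
  have scale: "(\<lambda>x. t * f x) \<in> A" if "f \<in> X" "\<bar>t\<bar> powr q * Lq_pow \<mu> q f \<le> 1" for f t
    using that by (simp add: A_iff Lq_pow_scale X_def span_fun_scale)
  have meas: "f \<in> borel_measurable \<mu>" if "f \<in> X" for f
    using borel_measurable_continuous_on_restrict[OF cont[OF that]]
    by (simp add: measurable_cong_sets[OF sets refl])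

  define R where "R = B * real N powr (1 / q)"
  have R: "R > 0"
    using B N by (simp add: R_def)
  have b0: "b 0 = real N powr (1 / q)"
    using N by (simp add: b_def)
  then have bd: "\<bar>f x\<bar> \<le> R" if "f \<in> A" "x \<in> \<Omega>" for f x
    using that scale[of _ "- 1"] cont ent[of 0]
    by (intro entropy_num_0_bound[OF comp]) (auto simp: A_iff R_def)

  \<comment> \<open>Doubling gives the strict inequality that \<open>entropy_num_net\<close> needs
    and costs only a constant.\<close>
  define \<eta> where "\<eta> k = 2 * (B * b k)" for k
  have \<eta>: "\<eta> k > 0" "B * b k < \<eta> k" for k
    using B b[of k] by (auto simp: \<eta>_def)
  have "\<forall>k. \<exists>G. finite G \<and> G \<noteq> {} \<and> G \<subseteq> A \<and> card G \<le> Nn k \<and> (\<forall>f\<in>A. \<exists>g\<in>G. sup_dist \<Omega> g f < \<eta> k)"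
    using entropy_num_net[OF ent \<eta>(2)] by blast
  then obtain G where G: "\<And>k. finite (G k) \<and> G k \<noteq> {} \<and> G k \<subseteq> A \<and> card (G k) \<le> Nn k"
    and G_net: "\<And>k f. f \<in> A \<Longrightarrow> \<exists>g\<in>G k. sup_dist \<Omega> g f < \<eta> k"
    by metis
  \<comment> \<open>The centre of \<open>G 0\<close> need not vanish. Zero can replace it, since the
    uniform bound \<open>R = B * b 0\<close> is below \<open>\<eta> 0\<close>.\<close>
  define F where "F k = (if k = 0 then {\<lambda>_. 0} else G k)" for k
  have zero: "(\<lambda>_. 0) \<in> A"
    by (simp add: A_iff X_def zero_in_span_fun Lq_pow_def)
  have F: "finite (F k) \<and> F k \<noteq> {} \<and> F k \<subseteq> A \<and> card (F k) \<le> Nn k" for k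
    using G[of k] zero by (auto simp: F_def Nn_def)
  have net: "\<exists>g\<in>F k. \<forall>x\<in>space \<mu>. \<bar>f x - g x\<bar> \<le> \<eta> k" if f: "f \<in> A" for k f
  proof (cases "k = 0")
    case True
    have "R \<le> \<eta> 0"
      using R b0 by (simp add: \<eta>_def R_def)
    then show ?thesis
      using True order.trans[OF bd[OF f]] sp by (simp add: F_def)
  next
    case False
    obtain g where g: "g \<in> G k" "sup_dist \<Omega> g f < \<eta> k"
      using G_net[OF f] by blast
    then have "g \<in> A"
      using G by blast
    have "\<bar>f x - g x\<bar> \<le> \<eta> k" if "x \<in> \<Omega>" for x
      using abs_diff_le_sup_dist[OF comp cont[of g] cont[of f] that] g(2) \<open>g \<in> A\<close> f
      by (simp add: A_iff abs_minus_commute)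
    then show ?thesis
      using False g(1) sp by (auto simp: F_def)
  qed

  obtain K where "b K \<le> 1 / (16 * q * B * R powr (q - 1))"
    using exists_small_entropy_bound[OF N, of "1 / (16 * q * B * R powr (q - 1))" q] q B R
    by (auto simp: b_def)
  then have fine: "q * \<eta> K * R powr (q - 1) \<le> 1/8"
    using q B R by (simp add: \<eta>_def field_simps)
  have size: "40 * (\<Sum>k<K. sqrt (2 ^ Suc k) * (sqrt 2 * q * (\<eta> (Suc k) + \<eta> k) * sqrt (R powr (q - 2)))) \<le> sqrt m"
  proof -
    define g where "g = 80 * sqrt 2 * q * B * sqrt (R powr (q - 2))"
    have g: "g \<ge> 0"
      using q B by (simp add: g_def)
    have "40 * (\<Sum>k<K. sqrt (2 ^ Suc k) * (sqrt 2 * q * (\<eta> (Suc k) + \<eta> k) * sqrt (R powr (q - 2))))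
        = g * (\<Sum>k<K. sqrt (2 ^ Suc k) * (b (Suc k) + b k))"
      unfolding sum_distrib_left by (intro sum.cong) (simp_all add: g_def \<eta>_def algebra_simps)
    also have "\<dots> \<le> g * (5/2 * (6 * sqrt Mx))"
    proof (rule mult_left_mono[OF _ g])
      have "(\<Sum>k\<le>K. sqrt (2 ^ k) * b k) \<le> 6 * sqrt Mx"
        using entropy_sum_le[OF q N, of K] by (simp add: b_def Mx_def)
      then show "(\<Sum>k<K. sqrt (2 ^ Suc k) * (b (Suc k) + b k)) \<le> 5/2 * (6 * sqrt Mx)"
        using shifted_sum_le[of b K, OF less_imp_le[OF b]] by linarith
    qed
    also have "\<dots> \<le> sqrt m"
    proof (rule real_le_rsqrt)
      have "1 / q * (q - 2) = 1 - 2 / q"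
        using q by (simp add: field_simps)
      then have "R powr (q - 2) = B powr (q - 2) * real N powr (1 - 2 / q)"
        using B by (simp only: R_def powr_mult powr_powr)
      then have "B\<^sup>2 * R powr (q - 2) = (B powr 2 * B powr (q - 2)) * real N powr (1 - 2 / q)"
        using B by (simp only: powr_numeral mult.assoc)
      also have "B powr 2 * B powr (q - 2) = B powr q"
        by (simp only: powr_add[symmetric]) simp
      finally have "B\<^sup>2 * R powr (q - 2) = B powr q * real N powr (1 - 2 / q)" .
      moreover have "(g * (5/2 * (6 * sqrt Mx)))\<^sup>2 = 2880000 * q\<^sup>2 * (B\<^sup>2 * R powr (q - 2)) * Mx"
        using Mx by (simp add: g_def power_mult_distrib)
      ultimately show "(g * (5/2 * (6 * sqrt Mx)))\<^sup>2 \<le> real m"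
        using m by (simp only: mult.assoc)
    qed
    finally show ?thesis .
  qed

  obtain \<xi> where \<xi>: "\<And>j. j < m \<Longrightarrow> \<xi> j \<in> \<Omega>"
    and ball: "\<And>f. f \<in> A \<Longrightarrow> \<bar>(1 / real m) * (\<Sum>j<m. \<bar>f (\<xi> j)\<bar> powr q) - Lq_pow \<mu> q f\<bar> \<le> 1/2"
  proof -
    have "\<exists>\<xi>. (\<forall>j<m. \<xi> j \<in> space \<mu>) \<and>
        (\<forall>f\<in>A. \<bar>(1 / real m) * (\<Sum>j<m. \<bar>f (\<xi> j)\<bar> powr q) - Lq_pow \<mu> q f\<bar> \<le> 1/2)"
      by (rule discretization_of_nets[OF prob _ R \<open>m > 0\<close>, where F = F and \<eta> = \<eta> and K = K])
        (use q meas bd F net fine size \<eta>(1) in \<open>auto simp: A_iff sp F_def\<close>)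
    then show ?thesis
      using that sp by blast
  qed
  have "1/2 * Lq_pow \<mu> q f \<le> (1 / real m) * (\<Sum>j<m. \<bar>f (\<xi> j)\<bar> powr q) \<and>
      (1 / real m) * (\<Sum>j<m. \<bar>f (\<xi> j)\<bar> powr q) \<le> 3/2 * Lq_pow \<mu> q f" if f: "f \<in> X" for f
  proof (cases "Lq_pow \<mu> q f = 0")
    case True
    \<comment> \<open>Normalization is impossible here, but every multiple of f lies in
      \<open>A\<close> and is bounded by \<open>R\<close>. So f vanishes at every point, hence at
      any sample points, even those in null sets.\<close>
    have "f x = 0" if "x \<in> \<Omega>" for x
    proof (rule ccontr)
      assume "f x \<noteq> 0"
      have "\<bar>((R + 1) / f x) * f x\<bar> \<le> R"
        using bd[OF scale[OF f, of "(R + 1) / f x"] that] True by simp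
      then show False
        using \<open>f x \<noteq> 0\<close> R by simp
    qed
    then show ?thesis
      using \<xi> True q by simp
  next
    case False
    define p where "p = Lq_pow \<mu> q f"
    define S where "S = (1 / real m) * (\<Sum>j<m. \<bar>f (\<xi> j)\<bar> powr q)"
    \<comment> \<open>On functions of norm one the absolute error 1/2 is a relative error, and
      homogeneity carries it back to f.\<close>
    define t where "t = p powr (- 1 / q)"
    have p: "p > 0"
      using False Lq_pow_nonneg[of \<mu> q f] by (simp add: p_def)
    have t: "\<bar>t\<bar> powr q = 1 / p"
    proof -
      have "\<bar>t\<bar> = t" "- 1 / q * q = - 1"
        using q by (simp_all add: t_def)
      then have "\<bar>t\<bar> powr q = p powr - 1"
        by (simp only: t_def powr_powr)
      then show ?thesis
        using p by (simp add: powr_minus_divide)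
    qed
    have "(1 / real m) * (\<Sum>j<m. \<bar>t * f (\<xi> j)\<bar> powr q) = S / p"
      by (simp add: S_def abs_mult powr_mult t flip: sum_divide_distrib)
    moreover have "Lq_pow \<mu> q (\<lambda>x. t * f x) = 1"
      using p by (simp add: Lq_pow_scale t flip: p_def)
    moreover have "(\<lambda>x. t * f x) \<in> A"
      using scale[OF f, of t] p by (simp add: t flip: p_def)
    ultimately have "\<bar>S / p - 1\<bar> \<le> 1/2"
      using ball[of "\<lambda>x. t * f x"] by simp
    then have "1/2 \<le> S / p" "S / p \<le> 3/2"
      by linarith+
    then show ?thesis
      using p unfolding p_def[symmetric] S_def[symmetric] by (simp add: field_simps)
  qed
  with \<xi> show "\<exists>\<xi>::nat \<Rightarrow> (nat \<Rightarrow> real). (\<forall>j<m. \<xi> j \<in> \<Omega>) \<and>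
           (\<forall>f\<in>span_fun N \<phi>.
              1/2 * Lq_pow \<mu> q f \<le> (1 / real m) * (\<Sum>j<m. \<bar>f (\<xi> j)\<bar> powr q) \<and>
              (1 / real m) * (\<Sum>j<m. \<bar>f (\<xi> j)\<bar> powr q) \<le> 3/2 * Lq_pow \<mu> q f)"
    unfolding X_def by blast
qed

end
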